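(* Let $\mathbb{F}$ be a subfield of $\mathbb{C}$ which is closed under complex conjugation, and let $\Phi=(v_j)_{j\in J}$ and $\Psi=(w_j)_{j\in J}$ be finite sequences of vectors which span $\mathbb{F}$-vector spaces $X$ and $Y$, respectively. Then: 1. $\Phi$ and $\Psi$ are similar if and only if $P_\Phi=P_\Psi$. 2. $\Phi$ and $\Psi$ are projectively similar if and only if their canonical $m$-products for a determining set are equal; that is, for any determining set $D$ for the $m$-products of $(P_\Phi e_j)_{j\in J}$ (for instance, the set of all tuples $(j_1,\dots,j_m)\in J^m$, $1\le m\le |J|$), $\Phi$ and $\Psi$ are projectively similar if and only if $$\Delta_C(v_{j_1},\ldots,v_{j_m})=\Delta_C(w_{j_1},\ldots,w_{j_m})\qquad\text{for all }(j_1,\ldots,j_m)\in D.$$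
   Context: $\Phi$ and $\Psi$ are similar if there is an invertible $\mathbb{F}$-linear map $Q:X\to Y$ with $w_j=Qv_j$ for all $j$; they are projectively similar if there are an invertible $\mathbb{F}$-linear map $Q:X\to Y$ and unit scalars $c_j\in\mathbb{F}$, $|c_j|=1$, with $w_j=c_jQv_j$ for all $j$. Equip $\mathbb{F}^J$ with the Euclidean inner product $\langle a,b\rangle=\sum_j a_j\overline{b_j}$ and standard basis $(e_j)_{j\in J}$. The space of linear dependencies of $\Phi$ is $\mathrm{dep}(\Phi)=\{a\in\mathbb{F}^J:\sum_j a_jv_j=0\}$, and $P_\Phi$ denotes (the matrix of) the orthogonal projection of $\mathbb{F}^J$ onto the orthogonal complement $\mathrm{dep}(\Phi)^\perp$; similarly $P_\Psi$. The $m$-products of a finite sequence $(u_j)_{j\in J}$ in an inner product space are $\Delta(u_{j_1},\ldots,u_{j_m})=\langle u_{j_1},u_{j_2}\rangle\langle u_{j_2},u_{j_3}\rangle\cdots\langle u_{j_m},u_{j_1}\rangle$. The canonical $m$-products of $\Phi$ are the $m$-products of the columns of $P=P_\Phi$: $$\Delta_C(v_{j_1},\ldots,v_{j_m}):=\Delta(Pe_{j_1},\ldots,Pe_{j_m}),$$ and those of $\Psi$ are defined in the same way using $P_\Psi$. A set $D$ of index tuples $(j_1,\dots,j_m)$, with $1\le m\le|J|$ and entries in $J$, is a determining set for the $m$-products of $(u_j)_{j\in J}$ if all its $m$-products ($1\le m\le |J|$) can be determined from those with indices in $D$; i.e. any sequence $(u_j')_{j\in J}$ in a complex inner product space whose $m$-products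 agree with those of $(u_j)$ for all tuples in $D$ has all its $m$-products, $1\le m\le|J|$, equal to those of $(u_j)$. *)

theory Defs
  imports
    Complex_Main
    "HOL-Algebra.Subrings"
    "Jordan_Normal_Form.VS_Connect"
begin

section \<open>Scalars and similarity\<close>

text \<open>A subfield of the complex numbers is a set \<open>F\<close> with \<^term>\<open>subfield F (class_ring :: complex ring)\<close>;
  as a ring in its own right it is the following structure, over which vector spaces are taken.\<close>

abbreviation scalars :: "complex set \<Rightarrow> complex ring" where
  "scalars F \<equiv> class_ring\<lparr>carrier := F\<rparr>"

definition spanning_seq :: "complex set \<Rightarrow> (complex, 'a) module \<Rightarrow> 'j set \<Rightarrow> ('j \<Rightarrow> 'a) \<Rightarrow> bool" where
  "spanning_seq F X J v \<longleftrightarrow>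
     v \<in> J \<rightarrow> carrier X \<and> LinearCombinations.module.span (scalars F) X (v ` J) = carrier X"

definition invertible_linear ::
  "complex set \<Rightarrow> (complex, 'a) module \<Rightarrow> (complex, 'b) module \<Rightarrow> ('a \<Rightarrow> 'b) \<Rightarrow> bool" where
  "invertible_linear F X Y Q \<longleftrightarrow>
     linear_map (scalars F) X Y Q \<and> bij_betw Q (carrier X) (carrier Y)"

definition similar_seq ::
  "complex set \<Rightarrow> 'j set \<Rightarrow> (complex, 'a) module \<Rightarrow> ('j \<Rightarrow> 'a) \<Rightarrow> (complex, 'b) module \<Rightarrow> ('j \<Rightarrow> 'b) \<Rightarrow> bool" where
  "similar_seq F J X v Y w \<longleftrightarrow>
     (\<exists>Q. invertible_linear F X Y Q \<and> (\<forall>j\<in>J. w j = Q (v j)))"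

definition projectively_similar ::
  "complex set \<Rightarrow> 'j set \<Rightarrow> (complex, 'a) module \<Rightarrow> ('j \<Rightarrow> 'a) \<Rightarrow> (complex, 'b) module \<Rightarrow> ('j \<Rightarrow> 'b) \<Rightarrow> bool" where
  "projectively_similar F J X v Y w \<longleftrightarrow>
     (\<exists>Q c. invertible_linear F X Y Q \<and>
        (\<forall>j\<in>J. c j \<in> F \<and> cmod (c j) = 1 \<and> w j = c j \<odot>\<^bsub>Y\<^esub> Q (v j)))"

section \<open>The projection onto the orthogonal complement of the dependencies\<close>

text \<open>The coordinate space over \<open>F\<close> indexed by \<open>J\<close> is \<^term>\<open>J \<rightarrow>\<^sub>E F\<close>, the carrier of the library's
  \<open>func_space\<close>. Its elements are \<open>undefined\<close> outside \<open>J\<close>, so they are equal iff they agree on \<open>J\<close>;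
  the inner product below only looks at the coordinates in \<open>J\<close>.\<close>

definition cinner :: "'j set \<Rightarrow> ('j \<Rightarrow> complex) \<Rightarrow> ('j \<Rightarrow> complex) \<Rightarrow> complex" where
  "cinner J a b = (\<Sum>j\<in>J. a j * cnj (b j))"

definition std_vec :: "'j set \<Rightarrow> 'j \<Rightarrow> 'j \<Rightarrow> complex" where
  "std_vec J k = (\<lambda>j\<in>J. if j = k then 1 else 0)"

definition dep :: "complex set \<Rightarrow> 'j set \<Rightarrow> (complex, 'a) module \<Rightarrow> ('j \<Rightarrow> 'a) \<Rightarrow> ('j \<Rightarrow> complex) set" where
  "dep F J X v = {a \<in> J \<rightarrow>\<^sub>E F. (\<Oplus>\<^bsub>X\<^esub>j\<in>J. a j \<odot>\<^bsub>X\<^esub> v j) = \<zero>\<^bsub>X\<^esub>}"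

definition orth_complement :: "complex set \<Rightarrow> 'j set \<Rightarrow> ('j \<Rightarrow> complex) set \<Rightarrow> ('j \<Rightarrow> complex) set" where
  "orth_complement F J W = {a \<in> J \<rightarrow>\<^sub>E F. \<forall>b\<in>W. cinner J a b = 0}"

definition orth_projection ::
  "complex set \<Rightarrow> 'j set \<Rightarrow> ('j \<Rightarrow> complex) set \<Rightarrow> ('j \<Rightarrow> complex) \<Rightarrow> ('j \<Rightarrow> complex)" where
  "orth_projection F J W =
     (\<lambda>x \<in> J \<rightarrow>\<^sub>E F. THE p. p \<in> W \<and> (\<forall>b\<in>W. cinner J (\<lambda>j. x j - p j) b = 0))"

definition dep_projection ::
  "complex set \<Rightarrow> 'j set \<Rightarrow> (complex, 'a) module \<Rightarrow> ('j \<Rightarrow> 'a) \<Rightarrow> ('j \<Rightarrow> complex) \<Rightarrow> ('j \<Rightarrow> complex)" where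
  "dep_projection F J X v = orth_projection F J (orth_complement F J (dep F J X v))"

text \<open>The matrix of the projection; its \<open>k\<close>-th column is the image of the \<open>k\<close>-th standard basis vector.
  As a function on \<open>J \<times> J\<close> it is \<open>undefined\<close> elsewhere, so that equality is entrywise on \<open>J \<times> J\<close>.\<close>

definition dep_matrix ::
  "complex set \<Rightarrow> 'j set \<Rightarrow> (complex, 'a) module \<Rightarrow> ('j \<Rightarrow> 'a) \<Rightarrow> 'j \<times> 'j \<Rightarrow> complex" where
  "dep_matrix F J X v = (\<lambda>(i, k) \<in> J \<times> J. dep_projection F J X v (std_vec J k) i)"

definition dep_column ::
  "complex set \<Rightarrow> 'j set \<Rightarrow> (complex, 'a) module \<Rightarrow> ('j \<Rightarrow> 'a) \<Rightarrow> 'j \<Rightarrow> 'j \<Rightarrow> complex" where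
  "dep_column F J X v k = (\<lambda>i\<in>J. dep_matrix F J X v (i, k))"

section \<open>Products and determining sets\<close>

definition m_product :: "('v \<Rightarrow> 'v \<Rightarrow> complex) \<Rightarrow> ('j \<Rightarrow> 'v) \<Rightarrow> 'j list \<Rightarrow> complex" where
  "m_product ip u js = (\<Prod>i<length js. ip (u (js ! i)) (u (js ! (Suc i mod length js))))"

definition canonical_m_product ::
  "complex set \<Rightarrow> 'j set \<Rightarrow> (complex, 'a) module \<Rightarrow> ('j \<Rightarrow> 'a) \<Rightarrow> 'j list \<Rightarrow> complex" where
  "canonical_m_product F J X v js = m_product (cinner J) (dep_column F J X v) js"

definition index_tuples :: "'j set \<Rightarrow> 'j list set" where
  "index_tuples J = {js. set js \<subseteq> J \<and> 1 \<le> length js \<and> length js \<le> card J}"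

locale complex_inner_product_space = vectorspace "class_ring :: complex ring" V
  for V :: "(complex, 'v) module" (structure) +
  fixes ip :: "'v \<Rightarrow> 'v \<Rightarrow> complex"
  assumes ip_add_left: "\<lbrakk>x \<in> carrier V; y \<in> carrier V; z \<in> carrier V\<rbrakk> \<Longrightarrow> ip (x \<oplus> y) z = ip x z + ip y z"
    and ip_smult_left: "\<lbrakk>x \<in> carrier V; y \<in> carrier V\<rbrakk> \<Longrightarrow> ip (c \<odot>\<^bsub>V\<^esub> x) y = c * ip x y"
    and ip_commute: "\<lbrakk>x \<in> carrier V; y \<in> carrier V\<rbrakk> \<Longrightarrow> ip x y = cnj (ip y x)"
    and ip_pos: "\<lbrakk>x \<in> carrier V; x \<noteq> \<zero>\<rbrakk> \<Longrightarrow> Re (ip x x) > 0"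

text \<open>HOL cannot quantify over all types inside a definition, so the competing sequences range over all
  complex inner product spaces carried by subsets of the type \<^typ>\<open>'j \<Rightarrow> complex\<close>. For finite \<open>J\<close> this
  is no restriction: the theorem \<open>determining_set_any_space\<close> below shows that such a set is determining
  with respect to complex inner product spaces over an arbitrary type.\<close>

definition determining_set ::
  "'j set \<Rightarrow> ('u \<Rightarrow> 'u \<Rightarrow> complex) \<Rightarrow> ('j \<Rightarrow> 'u) \<Rightarrow> 'j list set \<Rightarrow> bool" where
  "determining_set J ip u D \<longleftrightarrow>
     D \<subseteq> index_tuples J \<and>
     (\<forall>(V :: (complex, 'j \<Rightarrow> complex) module) ip' u'.
        complex_inner_product_space V ip' \<and> u' \<in> J \<rightarrow> carrier V \<and>
        (\<forall>js\<in>D. m_product ip' u' js = m_product ip u js) \<longrightarrow>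
        (\<forall>js\<in>index_tuples J. m_product ip' u' js = m_product ip u js))"

lemma (in complex_inner_product_space) ip_add_right:
  assumes "x \<in> carrier V" "y \<in> carrier V" "z \<in> carrier V"
  shows "ip z (x \<oplus> y) = ip z x + ip z y"
  using ip_commute[of z "x \<oplus> y"] ip_commute[of z x] ip_commute[of z y] ip_add_left[of x y z] assms
  by simp

lemma (in complex_inner_product_space) ip_smult_right:
  assumes "x \<in> carrier V" "y \<in> carrier V"
  shows "ip y (c \<odot>\<^bsub>V\<^esub> x) = cnj c * ip y x"
proof -
  have "c \<odot>\<^bsub>V\<^esub> x \<in> carrier V" using assms by (simp add: smult_closed)
  then show ?thesis
    using ip_commute[of y "c \<odot>\<^bsub>V\<^esub> x"] ip_commute[of y x] ip_smult_left[of x y c] assms by simp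
qed

lemma (in complex_inner_product_space) gram_coordinates:
  assumes "finite J" "u \<in> J \<rightarrow> carrier V"
  shows "\<exists>c :: 'j \<Rightarrow> 'j \<Rightarrow> complex. \<forall>i\<in>J. \<forall>j\<in>J. ip (u i) (u j) = cinner J (c i) (c j)"
  using assms
proof (induction J arbitrary: u rule: finite_induct)
  case empty
  then show ?case by simp
next
  case (insert k J)
  have uk: "u k \<in> carrier V" and uJ: "\<And>i. i \<in> J \<Longrightarrow> u i \<in> carrier V"
    using insert.prems by auto
  define n where "n = ip (u k) (u k)"
  define t where "t = (\<lambda>i. - (ip (u i) (u k) / n))"
  define u' where "u' = (\<lambda>i. u i \<oplus> t i \<odot>\<^bsub>V\<^esub> u k)"
  have su: "t i \<odot>\<^bsub>V\<^esub> u k \<in> carrier V" for i using uk by (simp add: smult_closed)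
  have "u' \<in> J \<rightarrow> carrier V" unfolding u'_def using uJ su by auto
  then obtain c where c: "\<And>i j. i \<in> J \<Longrightarrow> j \<in> J \<Longrightarrow> ip (u' i) (u' j) = cinner J (c i) (c j)"
    using insert.IH by blast
  have n_cnj: "cnj n = n" unfolding n_def using ip_commute[OF uk uk] by simp
  then have n_real: "n = of_real (Re n)" by (simp add: complex_eq_iff)
  have zero_ip: "ip \<zero> x = 0" if "x \<in> carrier V" for x
    using ip_add_left[of \<zero> \<zero> x] that by simp
  have n_nonneg: "Re n \<ge> 0"
    using ip_pos[OF uk] zero_ip[of "\<zero>"] unfolding n_def by (cases "u k = \<zero>") auto
  have deg: "ip (u i) (u k) = 0" if "n = 0" "u i \<in> carrier V" for i
  proof -
    have "u k = \<zero>" using ip_pos[OF uk] that(1) unfolding n_def by force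
    then show ?thesis using zero_ip[OF that(2)] ip_commute[OF that(2) uk] by simp
  qed
  define s where "s = complex_of_real (sqrt (Re n))"
  have "s * s = of_real (Re n)"
    using n_nonneg unfolding s_def by (simp flip: of_real_mult)
  then have ss: "s * s = n" by (rule trans[OF _ n_real[symmetric]])
  have s_cnj: "cnj s = s" unfolding s_def by simp
  have exp: "ip (u i) (u j) = ip (u' i) (u' j) + (ip (u i) (u k) / s) * cnj (ip (u j) (u k) / s)"
    if i: "i \<in> J" and j: "j \<in> J" for i j
  proof -
    have "ip (u' i) (u' j) = ip (u i) (u j) + cnj (t j) * ip (u i) (u k)
        + t i * (ip (u k) (u j) + cnj (t j) * n)"
      unfolding u'_def n_def using uJ[OF i] uJ[OF j] uk su
      by (simp add: ip_add_left ip_add_right ip_smult_left ip_smult_right algebra_simps)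
    moreover have "ip (u k) (u j) + cnj (t j) * n = 0"
      using deg[OF _ uJ[OF j]] ip_commute[OF uk uJ[OF j]] n_cnj unfolding t_def by (cases "n = 0") auto
    ultimately have "ip (u' i) (u' j) = ip (u i) (u j) + cnj (t j) * ip (u i) (u k)" by simp
    moreover have "cnj (t j) * ip (u i) (u k) = - ((ip (u i) (u k) / s) * cnj (ip (u j) (u k) / s))"
      using s_cnj n_cnj unfolding t_def by (simp flip: ss)
    ultimately show ?thesis by simp
  qed
  define d where "d = (\<lambda>i j. if i = k then (if j = k then s else 0)
                             else if j = k then ip (u i) (u k) / s else c i j)"
  have kJ: "k \<notin> J" by (rule insert.hyps)
  have split: "cinner (insert k J) a b = a k * cnj (b k) + cinner J a b" for a b
    unfolding cinner_def using insert.hyps by simp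
  have 1: "cinner J (d i) (d j) = (if i = k \<or> j = k then 0 else cinner J (c i) (c j))" for i j
    unfolding cinner_def d_def using kJ by (auto intro!: sum.neutral sum.cong)
  have "ip (u i) (u j) = cinner (insert k J) (d i) (d j)"
    if "i \<in> insert k J" "j \<in> insert k J" for i j
  proof -
    consider "i = k" "j = k" | "i = k" "j \<in> J" | "i \<in> J" "j = k" | "i \<in> J" "j \<in> J"
      using \<open>i \<in> insert k J\<close> \<open>j \<in> insert k J\<close> by auto
    then show ?thesis
    proof cases
      case 1
      then show ?thesis unfolding split \<open>\<And>i j. cinner J (d i) (d j) = _\<close>
        by (simp add: d_def ss s_cnj n_def)
    next
      case 2
      then have "j \<noteq> k" using kJ by auto
      with 2 show ?thesis unfolding split \<open>\<And>i j. cinner J (d i) (d j) = _\<close>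
        using deg[OF _ uJ[of j]] ip_commute[OF uk uJ[of j]] ss s_cnj
        by (cases "s = 0") (auto simp: d_def)
    next
      case 3
      then have "i \<noteq> k" using kJ by auto
      with 3 show ?thesis unfolding split \<open>\<And>i j. cinner J (d i) (d j) = _\<close>
        using deg[OF _ uJ[of i]] ss s_cnj by (cases "s = 0") (auto simp: d_def)
    next
      case 4
      then have "i \<noteq> k" "j \<noteq> k" using kJ by auto
      with 4 show ?thesis unfolding split \<open>\<And>i j. cinner J (d i) (d j) = _\<close>
        using exp[of i j] c[of i j] by (simp add: d_def)
    qed
  qed
  then show ?case by blast
qed

lemma coordinate_space_complex_inner_product_space:
  assumes "finite J"
  shows "complex_inner_product_space (LinearCombinations.ring.func_space class_ring J) (cinner J)"
    (is "complex_inner_product_space ?V _")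
proof -
  have "module (class_ring :: complex ring) ?V" by (rule class_cring.func_space_is_module)
  moreover have "field (class_ring :: complex ring)" by (rule class_field.field_axioms)
  ultimately have vs: "vectorspace (class_ring :: complex ring) ?V"
    by (simp add: vectorspace_def)
  note fs = class_ring.func_space_def
  show ?thesis
  proof (intro complex_inner_product_space.intro[OF vs] complex_inner_product_space_axioms.intro)
    fix x assume x: "x \<in> carrier ?V" "x \<noteq> \<zero>\<^bsub>?V\<^esub>"
    have "\<exists>k\<in>J. x k \<noteq> 0"
    proof (rule ccontr)
      assume "\<not> ?thesis"
      then have "x = \<zero>\<^bsub>?V\<^esub>" using x(1)
        by (intro ext) (auto simp: fs PiE_def extensional_def)
      with x(2) show False by blast
    qed
    then obtain k where k: "k \<in> J" "x k \<noteq> 0" by blast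
    have "Re (cinner J x x) = (\<Sum>j\<in>J. (cmod (x j))\<^sup>2)"
      unfolding cinner_def by (simp add: complex_mult_cnj cmod_power2 del: of_real_add)
    moreover have "\<dots> > 0" using assms k by (intro sum_pos2[of J k]) auto
    ultimately show "Re (cinner J x x) > 0" by simp
  qed (simp_all add: fs cinner_def sum.distrib sum_distrib_left distrib_right mult.assoc mult.commute[of "cnj _"])
qed

theorem determining_set_any_space:
  fixes V :: "(complex, 'c) module" and J :: "'j set"
  assumes "determining_set J ip u D" and "finite J"
    and "complex_inner_product_space V ip'" and "u' \<in> J \<rightarrow> carrier V"
    and agree: "\<forall>js\<in>D. m_product ip' u' js = m_product ip u js"
    and js: "js \<in> index_tuples J"
  shows "m_product ip' u' js = m_product ip u js"
proof -
  interpret V: complex_inner_product_space V ip' by fact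
  obtain c :: "'j \<Rightarrow> 'j \<Rightarrow> complex"
    where c: "\<And>i j. i \<in> J \<Longrightarrow> j \<in> J \<Longrightarrow> ip' (u' i) (u' j) = cinner J (c i) (c j)"
    using V.gram_coordinates[OF assms(2) assms(4)] by blast
  define r where "r = (\<lambda>i. restrict (c i) J)"
  have r: "ip' (u' i) (u' j) = cinner J (r i) (r j)" if "i \<in> J" "j \<in> J" for i j
    using c[OF that] by (simp add: r_def cinner_def)
  have eq: "m_product ip' u' ks = m_product (cinner J) r ks" if "ks \<in> index_tuples J" for ks
    unfolding m_product_def
  proof (rule prod.cong[OF refl])
    fix i assume "i \<in> {..<length ks}"
    then have "i < length ks" "Suc i mod length ks < length ks"
      by (auto intro: mod_less_divisor)
    then have "ks ! i \<in> J" "ks ! (Suc i mod length ks) \<in> J"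
      using that nth_mem[of i ks] nth_mem[of "Suc i mod length ks" ks]
      unfolding index_tuples_def by blast+
    then show "ip' (u' (ks ! i)) (u' (ks ! (Suc i mod length ks)))
        = cinner J (r (ks ! i)) (r (ks ! (Suc i mod length ks)))" by (rule r)
  qed
  have D: "D \<subseteq> index_tuples J" using assms(1) by (simp add: determining_set_def)
  have "r \<in> J \<rightarrow> carrier (LinearCombinations.ring.func_space class_ring J)"
    by (auto simp: r_def class_ring.func_space_def)
  moreover have "\<forall>ks\<in>D. m_product (cinner J) r ks = m_product ip u ks"
    using agree eq D by (metis subsetD)
  ultimately have "m_product (cinner J) r js = m_product ip u js"
    using assms(1) coordinate_space_complex_inner_product_space[OF assms(2)] js
    unfolding determining_set_def by blast
  then show ?thesis using eq[OF js] by simp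
qed

end

theory Submission
  imports Defs
begin

text \<open>The projection onto the complement of a subspace of the coordinate space determines that subspace,
  and sequences with the same dependencies are related by the linear map sending one to the other; hence
  similarity is equality of the projections. Scaling the vectors by unit scalars conjugates the projection
  by a unitary diagonal matrix. As the projection is the Gram matrix of its own columns, up to
  transposition, projective similarity amounts to
  \<open>H i j = c i * cnj (c j) * G i j\<close> for two Hermitian matrices over \<open>F\<close>, where the \<open>c i\<close> must be scalars of modulus one in \<open>F\<close>.
  Such scalars exist iff \<open>G\<close> and \<open>H\<close> have the same products along closed walks, and walks visiting at
  most \<open>card J\<close> vertices suffice.\<close>

section \<open>Orthogonal projections over a conjugation-closed field\<close>

text \<open>\<open>F\<close> need not contain square roots or absolute values of its elements, so
  neither orthonormal bases nor normalized entries are available. Projections still exist over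
  \<open>F\<close>: closure under conjugation keeps inner products in \<open>F\<close>, and
  \<open>cinner J a a\<close> is nonzero unless \<open>a\<close> vanishes on \<open>J\<close>, so
  the quotients of unnormalized Gram-Schmidt make sense. The phases are quotients of products of
  entries of the two Gram matrices. Such quotients lie in \<open>F\<close>, and they have modulus
  one because the closed walks through two vertices force corresponding entries to have equal
  moduli. The transposition arises because \<open>cinner\<close> is linear in its first argument:
  the inner product of columns \<open>j\<close> and \<open>k\<close> of the projection
  \<open>P\<close> is the entry \<open>P k j\<close>. An arbitrary determining set reduces to the
  set of all tuples, because the columns of the second projection are one of the competing
  sequences.\<close>

lemma cinner_add_left: "cinner J (\<lambda>j. a j + b j) d = cinner J a d + cinner J b d"
  by (simp add: cinner_def distrib_right sum.distrib)

lemma cinner_diff_left: "cinner J (\<lambda>j. a j - b j) d = cinner J a d - cinner J b d"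
  by (simp add: cinner_def left_diff_distrib sum_subtractf)

lemma cinner_smult_left: "cinner J (\<lambda>j. s * a j) d = s * cinner J a d"
  by (simp add: cinner_def sum_distrib_left mult.assoc)

lemma cinner_commute: "cinner J a b = cnj (cinner J b a)"
  by (simp add: cinner_def mult.commute)

lemma cinner_add_right: "cinner J d (\<lambda>j. a j + b j) = cinner J d a + cinner J d b"
  by (simp add: cinner_def distrib_left sum.distrib)

lemma cinner_diff_right: "cinner J d (\<lambda>j. a j - b j) = cinner J d a - cinner J d b"
  by (simp add: cinner_def right_diff_distrib sum_subtractf)

lemma cinner_smult_right: "cinner J d (\<lambda>j. s * a j) = cnj s * cinner J d a"
  by (simp add: cinner_def sum_distrib_left mult.left_commute)

lemmas cinner_linear = cinner_add_left cinner_diff_left cinner_smult_left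
  cinner_add_right cinner_diff_right cinner_smult_right

lemma cinner_cong:
  "\<lbrakk>\<And>j. j \<in> J \<Longrightarrow> a j = a' j; \<And>j. j \<in> J \<Longrightarrow> b j = b' j\<rbrakk> \<Longrightarrow> cinner J a b = cinner J a' b'"
  by (simp add: cinner_def)

lemma cinner_unit_right:
  assumes "finite J" "k \<in> J"
  shows "cinner J a (\<lambda>j. of_bool (j = k)) = a k"
proof -
  have "cinner J a (\<lambda>j. of_bool (j = k)) = (\<Sum>j\<in>J. if j = k then a j else 0)"
    unfolding cinner_def by (rule sum.cong) auto
  then show ?thesis using assms by simp
qed

lemma cinner_self_eq_0:
  assumes "finite J" "cinner J a a = 0" "j \<in> J"
  shows "a j = 0"
proof -
  have "complex_of_real (\<Sum>j\<in>J. (cmod (a j))\<^sup>2) = 0"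
    using assms(2) unfolding cinner_def by (simp only: complex_norm_square[symmetric] of_real_sum)
  then have "(\<Sum>j\<in>J. (cmod (a j))\<^sup>2) = 0" by (simp only: of_real_eq_0_iff)
  then show ?thesis using assms(1,3) by (simp add: sum_nonneg_eq_0_iff)
qed

locale conj_subfield =
  fixes F :: "complex set"
  assumes subfield: "subfield F (class_ring :: complex ring)"
    and cnj_closed: "z \<in> F \<Longrightarrow> cnj z \<in> F"
begin

lemma zero_closed: "0 \<in> F" and one_closed: "1 \<in> F"
  and add_closed: "\<lbrakk>x \<in> F; y \<in> F\<rbrakk> \<Longrightarrow> x + y \<in> F"
  and mult_closed: "\<lbrakk>x \<in> F; y \<in> F\<rbrakk> \<Longrightarrow> x * y \<in> F"
  and uminus_closed: "x \<in> F \<Longrightarrow> - x \<in> F"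
  using subringE[OF subfieldE(1)[OF subfield]] by (simp_all add: class_ring_simps)

lemma diff_closed: "\<lbrakk>x \<in> F; y \<in> F\<rbrakk> \<Longrightarrow> x - y \<in> F"
  using add_closed[of x "- y"] uminus_closed by simp

lemma divide_closed:
  assumes "x \<in> F" "y \<in> F"
  shows "x / y \<in> F"
proof (cases "y = 0")
  case False
  then have "y \<in> Units (scalars F)"
    using subfield.subfield_Units[OF subfield] assms(2) by simp
  then obtain z where "z \<in> F" "z * y = 1" unfolding Units_def by auto
  then show ?thesis
    using mult_closed[OF assms(1), of z] False by (simp add: divide_inverse inverse_unique mult.commute)
qed (simp add: zero_closed)

lemma sum_closed: "(\<And>j. j \<in> J \<Longrightarrow> f j \<in> F) \<Longrightarrow> sum f J \<in> F"
  by (induction J rule: infinite_finite_induct) (auto intro: zero_closed add_closed)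

lemma cinner_closed:
  "\<lbrakk>\<And>j. j \<in> J \<Longrightarrow> a j \<in> F; \<And>j. j \<in> J \<Longrightarrow> b j \<in> F\<rbrakk> \<Longrightarrow> cinner J a b \<in> F"
  unfolding cinner_def by (intro sum_closed mult_closed cnj_closed)

end

text \<open>A subspace of the coordinate space over \<open>F\<close> indexed by \<open>J\<close>, given by arbitrary functions whose
  values outside \<open>J\<close> are irrelevant; unlike extensional functions, these are closed under the
  pointwise operations.\<close>

locale coordinate_subspace = conj_subfield F for F +
  fixes J :: "'j set" and N :: "('j \<Rightarrow> complex) set"
  assumes finite_index: "finite J"
    and coordinate_closed: "\<lbrakk>a \<in> N; j \<in> J\<rbrakk> \<Longrightarrow> a j \<in> F"
    and subspace_zero: "(\<lambda>_. 0) \<in> N"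
    and subspace_add: "\<lbrakk>a \<in> N; b \<in> N\<rbrakk> \<Longrightarrow> (\<lambda>j. a j + b j) \<in> N"
    and subspace_smult: "\<lbrakk>s \<in> F; a \<in> N\<rbrakk> \<Longrightarrow> (\<lambda>j. s * a j) \<in> N"
    and subspace_cong: "\<lbrakk>a \<in> N; \<And>j. j \<in> J \<Longrightarrow> a j = b j\<rbrakk> \<Longrightarrow> b \<in> N"
begin

lemma subspace_diff:
  assumes "a \<in> N" "b \<in> N"
  shows "(\<lambda>j. a j - b j) \<in> N"
  using subspace_add[OF assms(1) subspace_smult[OF uminus_closed[OF one_closed] assms(2)]] by simp

lemma subspace_sum: "(\<And>k. k \<in> K \<Longrightarrow> f k \<in> N) \<Longrightarrow> (\<lambda>j. \<Sum>k\<in>K. f k j) \<in> N"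
  by (induction K rule: infinite_finite_induct) (auto intro: subspace_zero subspace_add)

text \<open>Gram--Schmidt without normalization, which might leave \<open>F\<close>.\<close>

lemma orthogonal_decomposition:
  assumes "\<And>j. j \<in> J \<Longrightarrow> x j \<in> F"
  shows "\<exists>n\<in>N. \<forall>b\<in>N. cinner J (\<lambda>j. x j - n j) b = 0"
proof -
  \<comment> \<open>\<open>N' K\<close> consists of the vectors of \<open>N\<close> supported in
    \<open>K\<close>. Induction on this support adds at most one dimension at a time and replaces
    the choice of a basis.\<close>
  define N' where "N' K = {a \<in> N. \<forall>j\<in>J - K. a j = 0}" for K
  have "\<forall>x. (\<forall>j\<in>J. x j \<in> F) \<longrightarrow> (\<exists>n\<in>N' K. \<forall>b\<in>N' K. cinner J (\<lambda>j. x j - n j) b = 0)"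
    if "K \<subseteq> J" for K
    using finite_subset[OF that finite_index] that
  proof (induction K rule: finite_induct)
    case empty
    have "cinner J a b = 0" if "b \<in> N' {}" for a b
      using that unfolding cinner_def N'_def by simp
    moreover have "(\<lambda>_. 0) \<in> N' {}" unfolding N'_def by (simp add: subspace_zero)
    ultimately show ?case by blast
  next
    case (insert k K)
    have kJ: "k \<in> J" using insert.prems by simp
    have IH: "\<exists>n\<in>N' K. \<forall>b\<in>N' K. cinner J (\<lambda>j. x j - n j) b = 0" if "\<forall>j\<in>J. x j \<in> F" for x
      using insert that by simp
    show ?case
    proof (cases "\<exists>b\<in>N' (insert k K). b k \<noteq> 0")
      case False
      then have "N' (insert k K) = N' K" unfolding N'_def by auto
      then show ?thesis using IH by simp
    next
      case True
      then obtain b where b: "b \<in> N' (insert k K)" "b k \<noteq> 0" by blast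
      have bN: "b \<in> N" using b(1) unfolding N'_def by simp
      obtain n0 where n0: "n0 \<in> N' K" "\<And>d. d \<in> N' K \<Longrightarrow> cinner J (\<lambda>j. b j - n0 j) d = 0"
        using IH[of b] coordinate_closed[OF bN] by blast
      \<comment> \<open>\<open>n0\<close> vanishes at \<open>k\<close>, so \<open>b'\<close> keeps
        the nonzero \<open>k\<close>-th coordinate of \<open>b\<close> while becoming orthogonal to
        \<open>N' K\<close>. It spans the direction that \<open>N' (insert k K)\<close>
        adds.\<close>
      define b' where "b' = (\<lambda>j. b j - n0 j)"
      have b'N: "b' \<in> N' (insert k K)"
        using b n0(1) unfolding b'_def N'_def by (auto intro: subspace_diff)
      then have b'F: "b' j \<in> F" if "j \<in> J" for j
        using that unfolding N'_def by (auto intro: coordinate_closed)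
      have b'k: "b' k \<noteq> 0" using b(2) n0(1) kJ insert.hyps unfolding b'_def N'_def by simp
      have orth: "cinner J b' d = 0" if "d \<in> N' K" for d using n0(2)[OF that] unfolding b'_def .
      define q where "q = cinner J b' b'"
      have q0: "q \<noteq> 0" using cinner_self_eq_0[OF finite_index _ kJ, of b'] b'k unfolding q_def by blast
      show ?thesis
      proof (intro allI impI)
        fix x assume x: "\<forall>j\<in>J. x j \<in> F"
        obtain n1 where n1: "n1 \<in> N' K" "\<And>d. d \<in> N' K \<Longrightarrow> cinner J (\<lambda>j. x j - n1 j) d = 0"
          using IH[OF x] by blast
        define t where "t = cinner J x b' / q"
        have tF: "t \<in> F" unfolding t_def q_def using x b'F by (intro divide_closed cinner_closed) auto
        have "t * q = cinner J x b'" unfolding t_def using q0 by simp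
        define n where "n = (\<lambda>j. n1 j + t * b' j)"
        have "n \<in> N' (insert k K)"
          using n1(1) b'N tF unfolding n_def N'_def by (auto intro: subspace_add subspace_smult)
        moreover have "cinner J (\<lambda>j. x j - n j) d = 0" if d: "d \<in> N' (insert k K)" for d
        proof -
          \<comment> \<open>This multiple of \<open>b'\<close> cancels the \<open>k\<close>-th
            coordinate of \<open>d\<close>, so \<open>d\<close> splits into a vector of
            \<open>N' K\<close> and a multiple of \<open>b'\<close>; orthogonality is then checked
            on each summand.\<close>
          define s where "s = d k / b' k"
          have dN: "d \<in> N" using d unfolding N'_def by simp
          have sF: "s \<in> F" unfolding s_def
            using coordinate_closed[OF dN kJ] b'F[OF kJ] by (rule divide_closed)
          define d0 where "d0 = (\<lambda>j. d j - s * b' j)"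
          have "d0 k = 0" unfolding d0_def s_def using b'k by simp
          then have d0: "d0 \<in> N' K"
            using d b'N sF unfolding d0_def N'_def
            by (auto intro: subspace_diff subspace_smult) (metis DiffI insertE mult_zero_right)
          have d_eq: "d = (\<lambda>j. d0 j + s * b' j)" unfolding d0_def by simp
          have "cinner J n1 b' = 0" using orth[OF n1(1)] cinner_commute[of J n1 b'] by simp
          then show ?thesis
            unfolding d_eq n_def using n1(2)[OF d0] orth[OF d0] \<open>t * q = cinner J x b'\<close>
            by (simp add: cinner_linear q_def[symmetric])
        qed
        ultimately show "\<exists>n\<in>N' (insert k K). \<forall>b\<in>N' (insert k K). cinner J (\<lambda>j. x j - n j) b = 0"
          by blast
      qed
    qed
  qed
  from this[of J] assms show ?thesis unfolding N'_def by auto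
qed

end

text \<open>The matrix of the projection onto the orthogonal complement of \<open>N\<close>, given
  by how it splits each unit vector instead of by a definite description. Uniqueness, entries in
  \<open>F\<close>, the Gram property and the recovery of \<open>N\<close> are all read off from the
  two clauses.\<close>

definition complement_projection_matrix ::
  "'j set \<Rightarrow> ('j \<Rightarrow> complex) set \<Rightarrow> ('j \<Rightarrow> 'j \<Rightarrow> complex) \<Rightarrow> bool" where
  "complement_projection_matrix J N P \<longleftrightarrow>
     (\<forall>k\<in>J. (\<forall>b\<in>N. cinner J (\<lambda>i. P i k) b = 0) \<and> (\<lambda>i. of_bool (i = k) - P i k) \<in> N)"

context coordinate_subspace
begin

lemma orthogonal_in_subspace_eq_0:
  "\<lbrakk>a \<in> N; \<And>b. b \<in> N \<Longrightarrow> cinner J a b = 0; j \<in> J\<rbrakk> \<Longrightarrow> a j = 0"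
  using cinner_self_eq_0[OF finite_index] by blast

text \<open>The difference of two candidate columns lies in \<open>N\<close> and is orthogonal to
  \<open>N\<close>, hence vanishes on \<open>J\<close>.\<close>

lemma complement_projection_matrix_unique:
  assumes P: "complement_projection_matrix J N P" and P': "complement_projection_matrix J N P'"
    and "i \<in> J" "k \<in> J"
  shows "P i k = P' i k"
proof -
  have "(\<lambda>i. P' i k - P i k) \<in> N"
    using subspace_diff[of "\<lambda>i. of_bool (i = k) - P i k" "\<lambda>i. of_bool (i = k) - P' i k"]
      P P' \<open>k \<in> J\<close> unfolding complement_projection_matrix_def by simp
  moreover have "cinner J (\<lambda>i. P' i k - P i k) b = 0" if "b \<in> N" for b
    using P P' \<open>k \<in> J\<close> that unfolding complement_projection_matrix_def by (simp add: cinner_linear)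
  ultimately have "P' i k - P i k = 0" using \<open>i \<in> J\<close> by (rule orthogonal_in_subspace_eq_0)
  then show ?thesis by simp
qed

lemma complement_projection_matrix_closed:
  assumes P: "complement_projection_matrix J N P" and "i \<in> J" "k \<in> J"
  shows "P i k \<in> F"
proof -
  have "of_bool (i = k) - P i k \<in> F"
    using coordinate_closed[of "\<lambda>i. of_bool (i = k) - P i k" i] assms
    unfolding complement_projection_matrix_def by simp
  then show ?thesis
    using diff_closed[of "of_bool (i = k)" "of_bool (i = k) - P i k"] zero_closed one_closed
    by (cases "i = k") auto
qed

text \<open>Column \<open>j\<close> is orthogonal to the \<open>k\<close>-th unit vector minus
  column \<open>k\<close>, because that remainder lies in \<open>N\<close>. Column \<open>k\<close>
  can therefore be replaced by the unit vector, which picks out one entry.\<close>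

lemma complement_projection_matrix_gram:
  assumes P: "complement_projection_matrix J N P" and "j \<in> J" "k \<in> J"
  shows "cinner J (\<lambda>i. P i j) (\<lambda>i. P i k) = P k j"
proof -
  have "cinner J (\<lambda>i. P i j) (\<lambda>i. of_bool (i = k) - P i k) = 0"
    using assms unfolding complement_projection_matrix_def by simp
  then show ?thesis
    using cinner_unit_right[OF finite_index \<open>k \<in> J\<close>, of "\<lambda>i. P i j"] by (simp add: cinner_linear)
qed

text \<open>\<open>N\<close> is the kernel of the matrix, and so is determined by it. With
  \<open>p\<close> the image of \<open>a\<close>, the difference \<open>a - p\<close> lies in
  \<open>N\<close> and \<open>p\<close> is orthogonal to \<open>N\<close>; for \<open>a\<close> in
  \<open>N\<close> this puts \<open>p\<close> in \<open>N\<close> as well, so it vanishes.\<close>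

lemma mem_iff_complement_projection_matrix:
  assumes P: "complement_projection_matrix J N P"
  shows "a \<in> N \<longleftrightarrow> (\<forall>j\<in>J. a j \<in> F) \<and> (\<forall>i\<in>J. (\<Sum>k\<in>J. a k * P i k) = 0)"
proof -
  define p where "p i = (\<Sum>k\<in>J. a k * P i k)" for i
  have diff: "(\<lambda>i. a i - p i) \<in> N" if aF: "\<forall>j\<in>J. a j \<in> F"
  proof -
    have "(\<lambda>i. \<Sum>k\<in>J. a k * (of_bool (i = k) - P i k)) \<in> N"
      using P aF unfolding complement_projection_matrix_def
      by (intro subspace_sum subspace_smult) auto
    moreover have "(\<Sum>k\<in>J. a k * (of_bool (i = k) - P i k)) = a i - p i" if "i \<in> J" for i
    proof -
      have "(\<Sum>k\<in>J. a k * of_bool (i = k)) = (\<Sum>k\<in>J. if i = k then a k else 0)"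
        by (rule sum.cong) auto
      then show ?thesis using finite_index that by (simp add: p_def right_diff_distrib sum_subtractf)
    qed
    ultimately show ?thesis by (rule subspace_cong)
  qed
  have orth: "cinner J p b = 0" if "b \<in> N" for b
  proof -
    have "cinner J p b = (\<Sum>k\<in>J. a k * cinner J (\<lambda>i. P i k) b)"
      unfolding cinner_def p_def sum_distrib_left sum_distrib_right mult.assoc by (rule sum.swap)
    also have "\<dots> = 0" using P that unfolding complement_projection_matrix_def by simp
    finally show ?thesis .
  qed
  have "p i = 0" if "a \<in> N" "i \<in> J" for i
  proof -
    have "(\<lambda>i. a i - p i) \<in> N" using coordinate_closed[OF that(1)] by (intro diff) auto
    from subspace_diff[OF that(1) this] have "p \<in> N" by simp
    then show ?thesis using orth that(2) by (rule orthogonal_in_subspace_eq_0)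
  qed
  moreover have "a \<in> N" if "\<forall>j\<in>J. a j \<in> F" "\<forall>i\<in>J. p i = 0"
    using diff[OF that(1)] by (rule subspace_cong) (simp add: that(2))
  ultimately show ?thesis using coordinate_closed unfolding p_def by blast
qed

text \<open>Multiplication by the unit scalars \<open>c j\<close> is unitary and carries the new
  subspace to \<open>N\<close>, so it conjugates the projection. The new subspace will be that of
  the dependencies of the rescaled vectors.\<close>

lemma complement_projection_matrix_scale:
  assumes P: "complement_projection_matrix J N P"
    and cF: "\<And>j. j \<in> J \<Longrightarrow> c j \<in> F" and unit: "\<And>j. j \<in> J \<Longrightarrow> cmod (c j) = 1"
  shows "complement_projection_matrix J {b. (\<forall>j\<in>J. b j \<in> F) \<and> (\<lambda>j. b j * c j) \<in> N}
    (\<lambda>i k. cnj (c i) * c k * P i k)"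
  unfolding complement_projection_matrix_def
proof (intro ballI conjI CollectI)
  have unit': "cnj (c j) * c j = 1" if "j \<in> J" for j
    using unit[OF that] complex_norm_square[of "c j"] by (simp add: mult.commute)
  fix k assume k: "k \<in> J"
  show "cinner J (\<lambda>i. cnj (c i) * c k * P i k) b = 0"
    if "b \<in> {b. (\<forall>j\<in>J. b j \<in> F) \<and> (\<lambda>j. b j * c j) \<in> N}" for b
  proof -
    have "cinner J (\<lambda>i. cnj (c i) * c k * P i k) b = c k * cinner J (\<lambda>i. P i k) (\<lambda>j. b j * c j)"
      unfolding cinner_def sum_distrib_left by (rule sum.cong) (simp_all add: mult_ac)
    then show ?thesis using P k that unfolding complement_projection_matrix_def by simp
  qed
  show "of_bool (j = k) - cnj (c j) * c k * P j k \<in> F" if j: "j \<in> J" for j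
  proof -
    have "cnj (c j) * c k * P j k \<in> F"
      by (intro mult_closed cnj_closed cF j k complement_projection_matrix_closed[OF P])
    then show ?thesis using diff_closed zero_closed one_closed by (simp only: of_bool_def split: if_split) simp
  qed
  \<comment> \<open>After multiplication by \<open>c i\<close>, the identity
    \<open>cnj (c i) * c i = 1\<close> turns the new remainder into \<open>c k\<close> times the old
    one.\<close>
  have "(\<lambda>i. c k * (of_bool (i = k) - P i k)) \<in> N"
    using P k cF unfolding complement_projection_matrix_def by (intro subspace_smult) auto
  moreover have "c k * (of_bool (i = k) - P i k) = (of_bool (i = k) - cnj (c i) * c k * P i k) * c i"
    if "i \<in> J" for i
  proof -
    have "(of_bool (i = k) - cnj (c i) * c k * P i k) * c i
        = of_bool (i = k) * c i - (cnj (c i) * c i) * (c k * P i k)"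
      by (simp add: algebra_simps)
    then show ?thesis unfolding unit'[OF that] by (cases "i = k") (simp_all add: algebra_simps)
  qed
  ultimately show "(\<lambda>i. (of_bool (i = k) - cnj (c i) * c k * P i k) * c i) \<in> N"
    by (rule subspace_cong)
qed

end

section \<open>Products along walks\<close>

fun walk_product :: "('j \<Rightarrow> 'j \<Rightarrow> complex) \<Rightarrow> 'j list \<Rightarrow> complex" where
  "walk_product G (x # y # xs) = G x y * walk_product G (y # xs)"
| "walk_product G xs = 1"

lemma walk_product_conv_prod: "walk_product G xs = (\<Prod>i<length xs - 1. G (xs ! i) (xs ! Suc i))"
proof (induction G xs rule: walk_product.induct)
  case (1 G x y xs)
  have "(\<Prod>i<length (x # y # xs) - 1. G ((x # y # xs) ! i) ((x # y # xs) ! Suc i))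
      = G x y * (\<Prod>i<length xs. G ((y # xs) ! i) ((y # xs) ! Suc i))"
    using prod.lessThan_Suc_shift[of "\<lambda>i. G ((x # y # xs) ! i) ((x # y # xs) ! Suc i)" "length xs"]
    by simp
  then show ?case using 1 by simp
qed simp_all

text \<open>Repeating the first vertex at the end replaces the wrap-around modulo the length by an
  ordinary walk, which can be cut and reversed as a list.\<close>

lemma m_product_conv_walk_product:
  assumes "js \<noteq> []"
  shows "m_product ip u js = walk_product (\<lambda>i j. ip (u i) (u j)) (js @ [hd js])"
  unfolding m_product_def walk_product_conv_prod
proof (rule prod.cong)
  show "{..<length js} = {..<length (js @ [hd js]) - 1}" by simp
next
  fix i assume "i \<in> {..<length (js @ [hd js]) - 1}"
  then have i: "i < length js" by simp
  have "js ! (Suc i mod length js) = (js @ [hd js]) ! Suc i"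
  proof (cases "Suc i = length js")
    case True
    then show ?thesis unfolding True using assms by (simp add: hd_conv_nth)
  next
    case False
    then show ?thesis using i by (simp add: nth_append)
  qed
  then show "ip (u (js ! i)) (u (js ! (Suc i mod length js)))
      = ip (u ((js @ [hd js]) ! i)) (u ((js @ [hd js]) ! Suc i))"
    using i by (simp add: nth_append)
qed

text \<open>Cutting at \<open>y\<close> makes it the end of one part and the start of the other, so
  each edge is counted exactly once.\<close>

lemma walk_product_append:
  "walk_product G (xs @ y # zs) = walk_product G (xs @ [y]) * walk_product G (y # zs)"
proof (induction xs)
  case (Cons x xs)
  then show ?case by (cases xs) simp_all
qed simp

lemma walk_product_rev:
  assumes "\<And>i j. \<lbrakk>i \<in> J; j \<in> J\<rbrakk> \<Longrightarrow> G j i = cnj (G i j)" and "set xs \<subseteq> J"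
  shows "walk_product G (rev xs) = cnj (walk_product G xs)"
  using assms(2)
proof (induction xs rule: induct_list012)
  case (3 x y xs)
  then show ?case
    using assms(1)[of x y] walk_product_append[of G "rev xs" y "[x]"] by simp
qed simp_all

lemma walk_product_cong:
  assumes "\<And>i j. \<lbrakk>i \<in> J; j \<in> J\<rbrakk> \<Longrightarrow> G i j = H i j" and "set xs \<subseteq> J"
  shows "walk_product G xs = walk_product H xs"
  using assms(2) by (induction xs rule: induct_list012) (simp_all add: assms(1))

text \<open>The scalars telescope, since each interior vertex \<open>y\<close> contributes
  \<open>c y * cnj (c y) = 1\<close>. On a closed walk the two ends cancel as well, so the product
  does not change.\<close>

lemma walk_product_scale:
  assumes "\<And>j. j \<in> J \<Longrightarrow> c j * cnj (c j) = 1" and "xs \<noteq> []" and "set xs \<subseteq> J"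
  shows "walk_product (\<lambda>i j. c i * cnj (c j) * G i j) xs
    = c (hd xs) * cnj (c (last xs)) * walk_product G xs"
  using assms(2,3)
proof (induction xs rule: induct_list012)
  case (3 x y xs)
  then have IH: "walk_product (\<lambda>i j. c i * cnj (c j) * G i j) (y # xs)
    = c y * cnj (c (last (y # xs))) * walk_product G (y # xs)" and y: "y \<in> J" by simp_all
  have "c x * cnj (c y) * G x y * (c y * cnj (c l) * p) = (c y * cnj (c y)) * (c x * cnj (c l) * (G x y * p))"
    for l p by (simp add: mult_ac)
  then show ?case using IH assms(1)[OF y] by simp
qed (simp_all add: assms(1))

text \<open>A closed walk longer than \<open>card J\<close> repeats a vertex and splits there into two shorter closed walks.\<close>

lemma closed_walk_products_eq:
  assumes "finite J"
    and eq: "\<And>js. js \<in> index_tuples J \<Longrightarrow> walk_product G (js @ [hd js]) = walk_product H (js @ [hd js])"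
    and "js \<noteq> []" "set js \<subseteq> J"
  shows "walk_product G (js @ [hd js]) = walk_product H (js @ [hd js])"
  using assms(3,4)
proof (induction js rule: length_induct)
  case (1 js)
  show ?case
  proof (cases "length js \<le> card J")
    case True
    then show ?thesis
      using "1.prems" by (intro eq) (cases js, auto simp: index_tuples_def)
  next
    case False
    have "\<not> distinct js"
      using False card_mono[OF assms(1) "1.prems"(2)] distinct_card[of js] by auto
    then obtain xs ys zs y where js: "js = xs @ [y] @ ys @ [y] @ zs"
      using not_distinct_decomp by blast
    \<comment> \<open>The first vertex of \<open>js\<close>, which is \<open>y\<close> if
      \<open>xs\<close> is empty. Cutting out the loop at \<open>y\<close> leaves it
      unchanged.\<close>
    define h where "h = hd (xs @ [y])"
    have "hd js = h" "hd (xs @ [y] @ zs) = h" unfolding js h_def by (cases xs; simp)+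
    have split: "walk_product K (js @ [hd js])
        = walk_product K ((y # ys) @ [hd (y # ys)])
          * walk_product K ((xs @ [y] @ zs) @ [hd (xs @ [y] @ zs)])" for K :: "'a \<Rightarrow> 'a \<Rightarrow> complex"
      unfolding \<open>hd js = h\<close> \<open>hd (xs @ [y] @ zs) = h\<close> unfolding js
      using walk_product_append[of K xs y "ys @ y # zs @ [h]"]
        walk_product_append[of K "y # ys" y "zs @ [h]"]
        walk_product_append[of K xs y "zs @ [h]"]
      by simp
    have "walk_product G ((y # ys) @ [hd (y # ys)]) = walk_product H ((y # ys) @ [hd (y # ys)])"
      using "1.prems" by (intro "1.IH"[rule_format]) (auto simp: js)
    moreover have "walk_product G ((xs @ [y] @ zs) @ [hd (xs @ [y] @ zs)])
        = walk_product H ((xs @ [y] @ zs) @ [hd (xs @ [y] @ zs)])"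
      using "1.prems" by (intro "1.IH"[rule_format]) (auto simp: js)
    ultimately show ?thesis unfolding split by simp
  qed
qed

lemma (in conj_subfield) walk_product_closed:
  assumes "\<And>i j. \<lbrakk>i \<in> J; j \<in> J\<rbrakk> \<Longrightarrow> G i j \<in> F" and "set xs \<subseteq> J"
  shows "walk_product G xs \<in> F"
  using assms(2) by (induction xs rule: induct_list012) (simp_all add: assms(1) one_closed mult_closed)

text \<open>In each connected component of the graph whose edges are the nonzero entries of \<open>G\<close>, fix a root
  and a walk from it to every vertex; the phase of a vertex is the quotient of the two products along
  that walk. The walk to \<open>i\<close>, the edge from \<open>i\<close> to \<open>j\<close> and the reversed walk to \<open>j\<close> form a closed walk.\<close>

lemma (in conj_subfield) phases_from_closed_walks:
  assumes G_closed: "\<And>i j. \<lbrakk>i \<in> J; j \<in> J\<rbrakk> \<Longrightarrow> G i j \<in> F"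
    and H_closed: "\<And>i j. \<lbrakk>i \<in> J; j \<in> J\<rbrakk> \<Longrightarrow> H i j \<in> F"
    and herm_G: "\<And>i j. \<lbrakk>i \<in> J; j \<in> J\<rbrakk> \<Longrightarrow> G j i = cnj (G i j)"
    and herm_H: "\<And>i j. \<lbrakk>i \<in> J; j \<in> J\<rbrakk> \<Longrightarrow> H j i = cnj (H i j)"
    and eq: "\<And>js. \<lbrakk>js \<noteq> []; set js \<subseteq> J\<rbrakk>
      \<Longrightarrow> walk_product G (js @ [hd js]) = walk_product H (js @ [hd js])"
  shows "\<exists>c. (\<forall>j\<in>J. c j \<in> F \<and> cmod (c j) = 1) \<and> (\<forall>i\<in>J. \<forall>j\<in>J. H i j = c i * cnj (c j) * G i j)"
proof -
  \<comment> \<open>Since the matrices are Hermitian, the closed walk through \<open>i\<close> and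
    \<open>j\<close> has the squared modulus of the entry as its product.\<close>
  have cmod_eq: "cmod (G i j) = cmod (H i j)" if "i \<in> J" "j \<in> J" for i j
  proof -
    have "G i j * G j i = H i j * H j i" using eq[of "[i, j]"] that by simp
    then have "complex_of_real ((cmod (G i j))\<^sup>2) = of_real ((cmod (H i j))\<^sup>2)"
      unfolding herm_G[OF that] herm_H[OF that] complex_norm_square .
    then have "(cmod (G i j))\<^sup>2 = (cmod (H i j))\<^sup>2" by (simp only: of_real_eq_iff)
    then show ?thesis by (simp add: power2_eq_iff_nonneg)
  qed
  have cmod_walk: "cmod (walk_product G xs) = cmod (walk_product H xs)" if "set xs \<subseteq> J" for xs
    using that by (induction xs rule: induct_list012) (simp_all add: norm_mult cmod_eq)
  define walk where "walk r j xs \<longleftrightarrow>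
    set xs \<subseteq> J \<and> xs \<noteq> [] \<and> hd xs = r \<and> last xs = j \<and> walk_product G xs \<noteq> 0" for r j xs
  \<comment> \<open>The choice depends only on the set of vertices from which \<open>j\<close> can
    be reached, so vertices joined by an edge receive literally the same root.\<close>
  define root where "root j = (SOME r. \<exists>xs. walk r j xs)" for j
  define p where "p j = (SOME xs. walk (root j) j xs)" for j
  have p: "walk (root j) j (p j)" if "j \<in> J" for j
  proof -
    have "\<exists>xs. walk j j xs" using that by (intro exI[of _ "[j]"]) (simp add: walk_def)
    then have "\<exists>xs. walk (root j) j xs" unfolding root_def by (rule someI[of "\<lambda>r. \<exists>xs. walk r j xs"])
    then show ?thesis unfolding p_def by (rule someI_ex)
  qed
  have snoc: "\<exists>ys. xs = ys @ [i]" if "walk r i xs" for r i xs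
    using that by (cases xs rule: rev_cases) (simp_all add: walk_def)
  have extend: "\<exists>xs. walk r j xs" if w: "walk r i xs" and ij: "i \<in> J" "j \<in> J" "G i j \<noteq> 0" for r i j xs
  proof -
    obtain ys where ys: "xs = ys @ [i]" using snoc[OF w] by blast
    have "walk_product G (xs @ [j]) = walk_product G xs * G i j"
      using walk_product_append[of G ys i "[j]"] ys by simp
    then have "walk r j (xs @ [j])" using w ij unfolding walk_def by simp
    then show ?thesis ..
  qed
  have root_eq: "root i = root j" if "i \<in> J" "j \<in> J" "G i j \<noteq> 0" for i j
  proof -
    have "G j i \<noteq> 0" using herm_G[OF that(1,2)] that(3) by simp
    then have "(\<exists>xs. walk r i xs) \<longleftrightarrow> (\<exists>xs. walk r j xs)" for r
      using extend[OF _ that] extend[OF _ that(2,1) \<open>G j i \<noteq> 0\<close>] by (intro iffI; elim exE)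
    then show ?thesis unfolding root_def by simp
  qed
  have pJ: "set (p j) \<subseteq> J" if "j \<in> J" for j using p[OF that] by (simp add: walk_def)
  \<comment> \<open>A solution normalized to 1 at the root must satisfy
    \<open>walk_product H (p j) = cnj (c j) * walk_product G (p j)\<close> by telescoping; modulus
    one turns this into the quotient of \<open>G\<close> by \<open>H\<close>.\<close>
  define c where "c j = walk_product G (p j) / walk_product H (p j)" for j
  have "c j \<in> F" if "j \<in> J" for j
    unfolding c_def using pJ[OF that] G_closed H_closed
    by (intro divide_closed walk_product_closed[of J]) auto
  moreover have "cmod (c j) = 1" if "j \<in> J" for j
    using p[OF that] cmod_walk[OF pJ[OF that]] by (auto simp: c_def walk_def norm_divide)
  moreover have "H i j = c i * cnj (c j) * G i j" if i: "i \<in> J" and j: "j \<in> J" for i j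
  proof (cases "G i j = 0")
    case True
    then show ?thesis using cmod_eq[OF i j] by simp
  next
    case False
    obtain xs where xs: "p i = xs @ [i]" using snoc[OF p[OF i]] by blast
    obtain ys where ys: "p j = ys @ [j]" using snoc[OF p[OF j]] by blast
    define r where "r = root j"
    have r: "hd (p i) = r" "hd (p j) = r"
      using p[OF i] p[OF j] root_eq[OF i j False] unfolding walk_def r_def by simp_all
    \<comment> \<open>\<open>p i @ rev (p j)\<close> ends at the common root where it starts.
      Dropping this last vertex brings it into the form \<open>zs @ [hd zs]\<close> to which
      \<open>eq\<close> applies.\<close>
    define zs where "zs = butlast (p i @ rev (p j))"
    have zs: "p i @ rev (p j) = zs @ [hd zs]" "zs \<noteq> []" "set zs \<subseteq> J"
    proof -
      have ne: "p i \<noteq> []" "p j \<noteq> []" using xs ys by simp_all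
      have *: "zs = p i @ butlast (rev (p j))" unfolding zs_def using ne by (simp add: butlast_append)
      then show "zs \<noteq> []" using ne by simp
      have "hd zs = last (rev (p j))" using * ne r by (simp add: last_rev)
      then show "p i @ rev (p j) = zs @ [hd zs]" unfolding * using ne by (simp del: butlast_rev last_rev)
      have "set (butlast (rev (p j))) \<subseteq> set (p j)" by (metis in_set_butlastD set_rev subsetI)
      then show "set zs \<subseteq> J" using pJ[OF i] pJ[OF j] unfolding * set_append by blast
    qed
    have split: "walk_product K (zs @ [hd zs]) = walk_product K (p i) * K i j * cnj (walk_product K (p j))"
      if "\<And>i j. \<lbrakk>i \<in> J; j \<in> J\<rbrakk> \<Longrightarrow> K j i = cnj (K i j)" for K
    proof -
      have "walk_product K (p i @ rev (p j)) = walk_product K (p i) * K i j * walk_product K (rev (p j))"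
        using walk_product_append[of K xs i "rev (p j)"] by (simp add: xs ys)
      moreover have "walk_product K (rev (p j)) = cnj (walk_product K (p j))"
        using that pJ[OF j] by (rule walk_product_rev)
      ultimately show ?thesis unfolding zs(1)[symmetric] by simp
    qed
    have *: "walk_product G (p i) * G i j * cnj (walk_product G (p j))
        = walk_product H (p i) * H i j * cnj (walk_product H (p j))"
    proof -
      have "walk_product G (zs @ [hd zs]) = walk_product G (p i) * G i j * cnj (walk_product G (p j))"
        by (rule split) (rule herm_G)
      moreover have "walk_product H (zs @ [hd zs]) = walk_product H (p i) * H i j * cnj (walk_product H (p j))"
        by (rule split) (rule herm_H)
      ultimately show ?thesis using eq[OF zs(2,3)] by simp
    qed
    have nz: "walk_product H (p i) \<noteq> 0" "walk_product H (p j) \<noteq> 0"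
      using p[OF i] p[OF j] cmod_walk[OF pJ[OF i]] cmod_walk[OF pJ[OF j]] by (auto simp: walk_def)
    have "c i * cnj (c j) * G i j
        = (walk_product G (p i) * G i j * cnj (walk_product G (p j)))
          / (walk_product H (p i) * cnj (walk_product H (p j)))"
      by (simp add: c_def)
    also have "\<dots> = H i j" unfolding * using nz by simp
    finally show ?thesis by (rule sym)
  qed
  ultimately show ?thesis by blast
qed

section \<open>Families in modules\<close>

lemma (in abelian_group) minus_eq_zero_iff:
  assumes "x \<in> carrier G" "y \<in> carrier G"
  shows "x \<ominus> y = \<zero> \<longleftrightarrow> x = y"
proof
  assume "x \<ominus> y = \<zero>"
  moreover have "x = (x \<ominus> y) \<oplus> y" using assms by (simp add: a_minus_def a_assoc l_neg)
  ultimately show "x = y" using assms by simp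
qed (use assms in \<open>simp add: a_minus_def r_neg\<close>)

context module
begin

lemma finsum_smult_add:
  assumes "a \<in> J \<rightarrow> carrier R" "b \<in> J \<rightarrow> carrier R" "v \<in> J \<rightarrow> carrier M"
  shows "(\<Oplus>\<^bsub>M\<^esub>j\<in>J. (a j \<oplus> b j) \<odot>\<^bsub>M\<^esub> v j)
    = (\<Oplus>\<^bsub>M\<^esub>j\<in>J. a j \<odot>\<^bsub>M\<^esub> v j) \<oplus>\<^bsub>M\<^esub> (\<Oplus>\<^bsub>M\<^esub>j\<in>J. b j \<odot>\<^bsub>M\<^esub> v j)"
proof -
  have "(\<Oplus>\<^bsub>M\<^esub>j\<in>J. (a j \<oplus> b j) \<odot>\<^bsub>M\<^esub> v j) = (\<Oplus>\<^bsub>M\<^esub>j\<in>J. a j \<odot>\<^bsub>M\<^esub> v j \<oplus>\<^bsub>M\<^esub> b j \<odot>\<^bsub>M\<^esub> v j)"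
    using assms by (intro M.finsum_cong') (auto simp: Pi_iff smult_l_distr)
  also have "\<dots> = (\<Oplus>\<^bsub>M\<^esub>j\<in>J. a j \<odot>\<^bsub>M\<^esub> v j) \<oplus>\<^bsub>M\<^esub> (\<Oplus>\<^bsub>M\<^esub>j\<in>J. b j \<odot>\<^bsub>M\<^esub> v j)"
    using assms by (intro M.finsum_addf) (auto simp: Pi_iff)
  finally show ?thesis .
qed

lemma finsum_smult_smult:
  assumes "s \<in> carrier R" "a \<in> J \<rightarrow> carrier R" "v \<in> J \<rightarrow> carrier M"
  shows "(\<Oplus>\<^bsub>M\<^esub>j\<in>J. (s \<otimes> a j) \<odot>\<^bsub>M\<^esub> v j) = s \<odot>\<^bsub>M\<^esub> (\<Oplus>\<^bsub>M\<^esub>j\<in>J. a j \<odot>\<^bsub>M\<^esub> v j)"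
proof -
  have "(\<Oplus>\<^bsub>M\<^esub>j\<in>J. (s \<otimes> a j) \<odot>\<^bsub>M\<^esub> v j) = (\<Oplus>\<^bsub>M\<^esub>j\<in>J. s \<odot>\<^bsub>M\<^esub> (a j \<odot>\<^bsub>M\<^esub> v j))"
    using assms by (intro M.finsum_cong') (auto simp: Pi_iff smult_assoc1)
  also have "\<dots> = s \<odot>\<^bsub>M\<^esub> (\<Oplus>\<^bsub>M\<^esub>j\<in>J. a j \<odot>\<^bsub>M\<^esub> v j)"
    using assms by (intro finsum_smult[symmetric]) (auto simp: Pi_iff)
  finally show ?thesis .
qed

lemma finsum_smult_diff:
  assumes "a \<in> J \<rightarrow> carrier R" "b \<in> J \<rightarrow> carrier R" "v \<in> J \<rightarrow> carrier M"
  shows "(\<Oplus>\<^bsub>M\<^esub>j\<in>J. (a j \<ominus> b j) \<odot>\<^bsub>M\<^esub> v j)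
    = (\<Oplus>\<^bsub>M\<^esub>j\<in>J. a j \<odot>\<^bsub>M\<^esub> v j) \<ominus>\<^bsub>M\<^esub> (\<Oplus>\<^bsub>M\<^esub>j\<in>J. b j \<odot>\<^bsub>M\<^esub> v j)"
proof -
  have B: "(\<lambda>j. \<ominus> b j) \<in> J \<rightarrow> carrier R" and bv: "(\<lambda>j. b j \<odot>\<^bsub>M\<^esub> v j) \<in> J \<rightarrow> carrier M"
    using assms by auto
  have "(\<Oplus>\<^bsub>M\<^esub>j\<in>J. (\<ominus> b j) \<odot>\<^bsub>M\<^esub> v j) = (\<Oplus>\<^bsub>M\<^esub>j\<in>J. (\<ominus> \<one> \<otimes> b j) \<odot>\<^bsub>M\<^esub> v j)"
    using assms by (intro M.finsum_cong') (auto simp: Pi_iff R.l_minus)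
  also have "\<dots> = (\<ominus> \<one>) \<odot>\<^bsub>M\<^esub> (\<Oplus>\<^bsub>M\<^esub>j\<in>J. b j \<odot>\<^bsub>M\<^esub> v j)"
    using assms by (intro finsum_smult_smult) auto
  also have "\<dots> = \<ominus>\<^bsub>M\<^esub> (\<Oplus>\<^bsub>M\<^esub>j\<in>J. b j \<odot>\<^bsub>M\<^esub> v j)"
    using M.finsum_closed[OF bv] by (simp add: smult_l_minus)
  finally show ?thesis
    unfolding a_minus_def finsum_smult_add[OF assms(1) B assms(3)] by (rule arg_cong)
qed

lemma finsum_smult_eq_iff:
  assumes "a \<in> J \<rightarrow> carrier R" "b \<in> J \<rightarrow> carrier R" "v \<in> J \<rightarrow> carrier M"
  shows "(\<Oplus>\<^bsub>M\<^esub>j\<in>J. a j \<odot>\<^bsub>M\<^esub> v j) = (\<Oplus>\<^bsub>M\<^esub>j\<in>J. b j \<odot>\<^bsub>M\<^esub> v j)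
    \<longleftrightarrow> (\<Oplus>\<^bsub>M\<^esub>j\<in>J. (a j \<ominus> b j) \<odot>\<^bsub>M\<^esub> v j) = \<zero>\<^bsub>M\<^esub>"
  unfolding finsum_smult_diff[OF assms]
  using assms by (intro M.minus_eq_zero_iff[symmetric] M.finsum_closed) (auto simp: Pi_iff)

lemma finsum_smult_unit:
  assumes "finite J" "k \<in> J" "v \<in> J \<rightarrow> carrier M"
  shows "(\<Oplus>\<^bsub>M\<^esub>j\<in>J. (if j = k then \<one> else \<zero>) \<odot>\<^bsub>M\<^esub> v j) = v k"
proof -
  have "(\<Oplus>\<^bsub>M\<^esub>j\<in>J. (if j = k then \<one> else \<zero>) \<odot>\<^bsub>M\<^esub> v j) = (\<Oplus>\<^bsub>M\<^esub>j\<in>J. if k = j then v j else \<zero>\<^bsub>M\<^esub>)"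
    using assms(3) by (intro M.finsum_cong') (auto simp: Pi_iff)
  also have "\<dots> = v k" using assms by (intro M.finsum_singleton)
  finally show ?thesis .
qed

text \<open>\<open>span\<close> works with sets of vectors, whereas a family may repeat vectors;
  coefficients indexed by \<open>J\<close> make spans comparable with dependencies. The right-hand
  side is a submodule containing the family, and the span, being a submodule, contains all these
  sums.\<close>

lemma span_image_eq:
  assumes "finite J" "v \<in> J \<rightarrow> carrier M"
  shows "span (v ` J) = {\<Oplus>\<^bsub>M\<^esub>j\<in>J. a j \<odot>\<^bsub>M\<^esub> v j | a. a \<in> J \<rightarrow> carrier R}" (is "_ = ?S")
proof
  have "submodule R ?S M"
  proof (unfold_locales)
    show "?S \<subseteq> carrier M" using assms(2) by (auto simp: Pi_iff intro!: M.finsum_closed)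
    have "(\<Oplus>\<^bsub>M\<^esub>j\<in>J. \<zero> \<odot>\<^bsub>M\<^esub> v j) = \<zero>\<^bsub>M\<^esub>"
      using assms(2) by (intro M.finsum_all0) (auto simp: Pi_iff)
    then show "\<zero>\<^bsub>M\<^esub> \<in> ?S" by (intro CollectI exI[of _ "\<lambda>_. \<zero>"]) auto
    fix x y assume "x \<in> ?S" "y \<in> ?S"
    then obtain a b where ab: "a \<in> J \<rightarrow> carrier R" "b \<in> J \<rightarrow> carrier R"
      "x = (\<Oplus>\<^bsub>M\<^esub>j\<in>J. a j \<odot>\<^bsub>M\<^esub> v j)" "y = (\<Oplus>\<^bsub>M\<^esub>j\<in>J. b j \<odot>\<^bsub>M\<^esub> v j)" by blast
    have "(\<lambda>j. a j \<oplus> b j) \<in> J \<rightarrow> carrier R" using ab(1,2) by (simp add: Pi_iff)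
    then show "x \<oplus>\<^bsub>M\<^esub> y \<in> ?S"
      unfolding ab(3,4) finsum_smult_add[OF ab(1,2) assms(2), symmetric]
      by (intro CollectI exI[of _ "\<lambda>j. a j \<oplus> b j"] conjI refl)
  next
    fix s x assume "s \<in> carrier R" "x \<in> ?S"
    then obtain a where a: "s \<in> carrier R" "a \<in> J \<rightarrow> carrier R" "x = (\<Oplus>\<^bsub>M\<^esub>j\<in>J. a j \<odot>\<^bsub>M\<^esub> v j)" by blast
    have "(\<lambda>j. s \<otimes> a j) \<in> J \<rightarrow> carrier R" using a(1,2) by (simp add: Pi_iff)
    then show "s \<odot>\<^bsub>M\<^esub> x \<in> ?S"
      unfolding a(3) finsum_smult_smult[OF a(1,2) assms(2), symmetric]
      by (intro CollectI exI[of _ "\<lambda>j. s \<otimes> a j"] conjI refl)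
  qed
  moreover have "v ` J \<subseteq> ?S"
  proof
    fix x assume "x \<in> v ` J"
    then obtain k where "k \<in> J" "x = v k" by blast
    then show "x \<in> ?S"
      using finsum_smult_unit[OF assms(1) \<open>k \<in> J\<close> assms(2)]
      by (intro CollectI exI[of _ "\<lambda>j. if j = k then \<one> else \<zero>"]) simp
  qed
  ultimately show "span (v ` J) \<subseteq> ?S" by (intro span_is_subset)
next
  interpret S: submodule R "span (v ` J)" M
    using assms(2) by (intro span_is_submodule) (auto simp: Pi_iff)
  have v: "v j \<in> span (v ` J)" if "j \<in> J" for j
    using in_own_span[of "v ` J"] assms(2) that by (auto simp: Pi_iff)
  have "(\<Oplus>\<^bsub>M\<^esub>j\<in>K. a j \<odot>\<^bsub>M\<^esub> v j) \<in> span (v ` J)" if "a \<in> J \<rightarrow> carrier R" "finite K" "K \<subseteq> J" for a K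
    using that(2,3)
  proof (induction K rule: finite_induct)
    case (insert k K)
    then show ?case
      using that(1) assms(2) v by (subst M.finsum_insert) (auto simp: Pi_iff subset_iff)
  qed simp
  then show "?S \<subseteq> span (v ` J)" using assms(1) by blast
qed

end

lemma (in mod_hom) hom_finsum:
  assumes "g \<in> J \<rightarrow> carrier M"
  shows "f (\<Oplus>\<^bsub>M\<^esub>j\<in>J. g j) = (\<Oplus>\<^bsub>N\<^esub>j\<in>J. f (g j))"
  using assms
proof (induction J rule: infinite_finite_induct)
  case (insert k J)
  then have "f (\<Oplus>\<^bsub>M\<^esub>j\<in>insert k J. g j) = f (g k) \<oplus>\<^bsub>N\<^esub> f (\<Oplus>\<^bsub>M\<^esub>j\<in>J. g j)"
    by (subst M.M.finsum_insert) (auto simp: Pi_iff intro!: f_add M.M.finsum_closed)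
  moreover have "(\<Oplus>\<^bsub>N\<^esub>j\<in>insert k J. f (g j)) = f (g k) \<oplus>\<^bsub>N\<^esub> (\<Oplus>\<^bsub>N\<^esub>j\<in>J. f (g j))"
    using insert by (subst N.M.finsum_insert) (auto simp: Pi_iff)
  ultimately show ?case using insert by (simp add: Pi_iff)
qed simp_all

text \<open>Forming linear combinations maps the coefficient families onto both spaces, by
  \<open>S\<close> and \<open>T\<close>. Equal kernels let \<open>T\<close> factor through
  \<open>S\<close>, and make the factor \<open>Q\<close> injective.\<close>

lemma linear_map_from_dependencies:
  assumes V: "vectorspace K V" and W: "vectorspace K W" and J: "finite J"
    and v: "v \<in> J \<rightarrow> carrier V" and w: "w \<in> J \<rightarrow> carrier W"
    and spanV: "LinearCombinations.module.span K V (v ` J) = carrier V"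
    and spanW: "LinearCombinations.module.span K W (w ` J) = carrier W"
    and dep: "\<And>a. a \<in> J \<rightarrow> carrier K \<Longrightarrow> (\<Oplus>\<^bsub>V\<^esub>j\<in>J. a j \<odot>\<^bsub>V\<^esub> v j) = \<zero>\<^bsub>V\<^esub>
      \<longleftrightarrow> (\<Oplus>\<^bsub>W\<^esub>j\<in>J. a j \<odot>\<^bsub>W\<^esub> w j) = \<zero>\<^bsub>W\<^esub>"
  shows "\<exists>Q. linear_map K V W Q \<and> bij_betw Q (carrier V) (carrier W) \<and> (\<forall>j\<in>J. w j = Q (v j))"
proof -
  interpret V: vectorspace K V by (rule V)
  interpret W: vectorspace K W by (rule W)
  define S where "S a = (\<Oplus>\<^bsub>V\<^esub>j\<in>J. a j \<odot>\<^bsub>V\<^esub> v j)" for a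
  define T where "T a = (\<Oplus>\<^bsub>W\<^esub>j\<in>J. a j \<odot>\<^bsub>W\<^esub> w j)" for a
  define C where "C = J \<rightarrow> carrier K"
  have carV: "carrier V = S ` C"
    unfolding spanV[symmetric] V.span_image_eq[OF J v] S_def C_def by (rule Setcompr_eq_image)
  have carW: "carrier W = T ` C"
    unfolding spanW[symmetric] W.span_image_eq[OF J w] T_def C_def by (rule Setcompr_eq_image)
  have ST: "S a = S b \<longleftrightarrow> T a = T b" if "a \<in> C" "b \<in> C" for a b
  proof -
    have ab: "a \<in> J \<rightarrow> carrier K" "b \<in> J \<rightarrow> carrier K" using that unfolding C_def .
    have "(\<lambda>j. a j \<ominus>\<^bsub>K\<^esub> b j) \<in> J \<rightarrow> carrier K" using ab by (auto simp: Pi_iff)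
    then show ?thesis
      unfolding S_def T_def V.finsum_smult_eq_iff[OF ab v] W.finsum_smult_eq_iff[OF ab w] by (rule dep)
  qed
  \<comment> \<open>Any preimage under \<open>S\<close> will do, since \<open>ST\<close> makes its
    image under \<open>T\<close> independent of the choice.\<close>
  define coeffs where "coeffs x = (SOME a. a \<in> C \<and> S a = x)" for x
  have coeffs: "coeffs x \<in> C \<and> S (coeffs x) = x" if "x \<in> carrier V" for x
  proof -
    have "\<exists>a. a \<in> C \<and> S a = x" using that unfolding carV by blast
    then show ?thesis unfolding coeffs_def by (rule someI_ex)
  qed
  define Q where "Q x = T (coeffs x)" for x
  have SV: "S a \<in> carrier V" and TW: "T a \<in> carrier W" if "a \<in> C" for a
    using that unfolding carV carW by simp_all
  have Q: "Q (S a) = T a" if "a \<in> C" for a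
    using coeffs[OF SV[OF that]] ST[of "coeffs (S a)" a] that unfolding Q_def by simp
  have "Q \<in> module_hom K V W"
    unfolding module_hom_def
  proof (intro CollectI conjI allI impI; (elim conjE)?)
    show "Q \<in> carrier V \<rightarrow> carrier W" unfolding carV using Q TW by auto
  next
    fix x y assume "x \<in> carrier V" "y \<in> carrier V"
    then obtain a b where a: "a \<in> C" "x = S a" and b: "b \<in> C" "y = S b" unfolding carV by blast
    have ab: "a \<in> J \<rightarrow> carrier K" "b \<in> J \<rightarrow> carrier K" using a(1) b(1) unfolding C_def .
    have "(\<lambda>j. a j \<oplus>\<^bsub>K\<^esub> b j) \<in> C" using ab by (auto simp: C_def Pi_iff)
    from Q[OF this] show "Q (x \<oplus>\<^bsub>V\<^esub> y) = Q x \<oplus>\<^bsub>W\<^esub> Q y"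
      unfolding a(2) b(2) Q[OF a(1)] Q[OF b(1)] unfolding S_def T_def
      by (simp add: V.finsum_smult_add[OF ab v] W.finsum_smult_add[OF ab w])
  next
    fix s x assume s: "s \<in> carrier K" and "x \<in> carrier V"
    then obtain a where a: "a \<in> C" "x = S a" unfolding carV by blast
    have a': "a \<in> J \<rightarrow> carrier K" using a(1) unfolding C_def .
    have "(\<lambda>j. s \<otimes>\<^bsub>K\<^esub> a j) \<in> C" using s a' by (auto simp: C_def Pi_iff)
    from Q[OF this] show "Q (s \<odot>\<^bsub>V\<^esub> x) = s \<odot>\<^bsub>W\<^esub> Q x"
      unfolding a(2) Q[OF a(1)] unfolding S_def T_def
      by (simp add: V.finsum_smult_smult[OF s a' v] W.finsum_smult_smult[OF s a' w])
  qed
  then have "linear_map K V W Q"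
    by (intro linear_map.intro mod_hom.intro mod_hom_axioms.intro V W V.module_axioms W.module_axioms)
  moreover have "bij_betw Q (carrier V) (carrier W)"
  proof (intro bij_betw_imageI inj_onI)
    show "Q ` carrier V = carrier W" unfolding carV carW image_image by (rule image_cong) (simp_all add: Q)
    fix x y assume "x \<in> carrier V" "y \<in> carrier V" "Q x = Q y"
    moreover from this obtain a b where "a \<in> C" "x = S a" "b \<in> C" "y = S b" unfolding carV by blast
    ultimately show "x = y" using Q ST by simp
  qed
  moreover have "w k = Q (v k)" if k: "k \<in> J" for k
  proof -
    let ?e = "\<lambda>j. if j = k then \<one>\<^bsub>K\<^esub> else \<zero>\<^bsub>K\<^esub>"
    have "?e \<in> C" unfolding C_def by auto
    then have "Q (S ?e) = T ?e" by (rule Q)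
    then show ?thesis
      unfolding S_def T_def V.finsum_smult_unit[OF J k v] W.finsum_smult_unit[OF J k w] by simp
  qed
  ultimately show ?thesis by blast
qed

section \<open>Linear dependencies\<close>

text \<open>The set \<open>dep\<close> without extensionality, so that it is a
  \<open>coordinate_subspace\<close>.\<close>

definition dependencies ::
  "complex set \<Rightarrow> 'j set \<Rightarrow> (complex, 'a) module \<Rightarrow> ('j \<Rightarrow> 'a) \<Rightarrow> ('j \<Rightarrow> complex) set" where
  "dependencies F J X v = {a. (\<forall>j\<in>J. a j \<in> F) \<and> (\<Oplus>\<^bsub>X\<^esub>j\<in>J. a j \<odot>\<^bsub>X\<^esub> v j) = \<zero>\<^bsub>X\<^esub>}"

lemma (in conj_subfield) coordinate_subspace_dependencies:
  assumes X: "vectorspace (scalars F) X" and J: "finite J" and v: "v \<in> J \<rightarrow> carrier X"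
  shows "coordinate_subspace F J (dependencies F J X v)"
proof unfold_locales
  interpret X: vectorspace "scalars F" X by (rule X)
  have v': "v j \<in> carrier X" if "j \<in> J" for j using v that by blast
  show "finite J" by (rule J)
  show "a j \<in> F" if "a \<in> dependencies F J X v" "j \<in> J" for a j
    using that unfolding dependencies_def by blast
  have "(\<Oplus>\<^bsub>X\<^esub>j\<in>J. 0 \<odot>\<^bsub>X\<^esub> v j) = \<zero>\<^bsub>X\<^esub>"
    using v' X.smult_l_null by (intro X.M.finsum_all0) simp
  then show "(\<lambda>_. 0) \<in> dependencies F J X v"
    unfolding dependencies_def using zero_closed by simp
next
  interpret X: vectorspace "scalars F" X by (rule X)
  fix a b assume a: "a \<in> dependencies F J X v" and b: "b \<in> dependencies F J X v"
  have "a \<in> J \<rightarrow> carrier (scalars F)" "b \<in> J \<rightarrow> carrier (scalars F)"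
    using a b unfolding dependencies_def by auto
  from X.finsum_smult_add[OF this v] show "(\<lambda>j. a j + b j) \<in> dependencies F J X v"
    using a b unfolding dependencies_def by (simp add: add_closed)
next
  interpret X: vectorspace "scalars F" X by (rule X)
  fix s a assume s: "s \<in> F" and a: "a \<in> dependencies F J X v"
  have "s \<in> carrier (scalars F)" "a \<in> J \<rightarrow> carrier (scalars F)"
    using s a unfolding dependencies_def by auto
  from X.finsum_smult_smult[OF this v] show "(\<lambda>j. s * a j) \<in> dependencies F J X v"
    using s a X.smult_r_null unfolding dependencies_def by (simp add: mult_closed)
next
  interpret X: vectorspace "scalars F" X by (rule X)
  fix a b assume a: "a \<in> dependencies F J X v" and eq: "\<And>j. j \<in> J \<Longrightarrow> a j = b j"
  have "(\<Oplus>\<^bsub>X\<^esub>j\<in>J. a j \<odot>\<^bsub>X\<^esub> v j) = (\<Oplus>\<^bsub>X\<^esub>j\<in>J. b j \<odot>\<^bsub>X\<^esub> v j)"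
    using a v eq X.smult_closed unfolding dependencies_def
    by (intro X.M.finsum_cong') (auto simp: Pi_iff)
  then show "b \<in> dependencies F J X v"
    using a eq unfolding dependencies_def by simp
qed

lemma mem_dep_iff: "a \<in> dep F J X v \<longleftrightarrow> a \<in> extensional J \<and> a \<in> dependencies F J X v"
  unfolding dep_def dependencies_def PiE_def by auto

text \<open>Links the definite description to its characterization. Decomposing a unit vector along
  the dependencies gives \<open>n\<close> among them and a rest \<open>p\<close> orthogonal to them.
  Then \<open>p\<close> lies in the complement \<open>W\<close> and \<open>n\<close> is orthogonal
  to \<open>W\<close>, so \<open>p\<close> is the projection onto \<open>W\<close>.\<close>

lemma (in conj_subfield) complement_projection_matrix_dep_matrix:
  assumes X: "vectorspace (scalars F) X" and J: "finite J" and v: "v \<in> J \<rightarrow> carrier X"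
  shows "complement_projection_matrix J (dependencies F J X v) (\<lambda>i k. dep_matrix F J X v (i, k))"
proof -
  let ?N = "dependencies F J X v"
  interpret N: coordinate_subspace F J ?N by (rule coordinate_subspace_dependencies[OF X J v])
  define W where "W = orth_complement F J (dep F J X v)"
  have restrict: "restrict n J \<in> dep F J X v" if "n \<in> ?N" for n
    using N.subspace_cong[OF that, of "restrict n J"] by (simp add: mem_dep_iff)
  have cinner_restrict: "cinner J a (restrict b J) = cinner J a b" for a b
    by (rule cinner_cong) simp_all
  have W_iff: "a \<in> W \<longleftrightarrow> a \<in> J \<rightarrow>\<^sub>E F \<and> (\<forall>n\<in>?N. cinner J a n = 0)" for a
  proof -
    have "(\<forall>b\<in>dep F J X v. cinner J a b = 0) \<longleftrightarrow> (\<forall>n\<in>?N. cinner J a n = 0)"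
    proof (intro iffI ballI)
      fix n assume "\<forall>b\<in>dep F J X v. cinner J a b = 0" "n \<in> ?N"
      then have "cinner J a (restrict n J) = 0" using restrict by blast
      then show "cinner J a n = 0" unfolding cinner_restrict .
    qed (simp add: mem_dep_iff)
    then show ?thesis unfolding W_def orth_complement_def by simp
  qed
  have column: "\<exists>n\<in>?N. (\<forall>b\<in>?N. cinner J (\<lambda>i. dep_matrix F J X v (i, k)) b = 0)
      \<and> (\<forall>i\<in>J. n i = of_bool (i = k) - dep_matrix F J X v (i, k))" if k: "k \<in> J" for k
  proof -
    define e where "e = std_vec J k"
    have e: "e \<in> J \<rightarrow>\<^sub>E F" unfolding e_def std_vec_def using zero_closed one_closed by auto
    have e': "e j = of_bool (j = k)" if "j \<in> J" for j using that by (simp add: e_def std_vec_def)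
    obtain n where n: "n \<in> ?N" "\<And>b. b \<in> ?N \<Longrightarrow> cinner J (\<lambda>j. e j - n j) b = 0"
      using N.orthogonal_decomposition[of e] e by blast
    define p where "p = (\<lambda>j\<in>J. e j - n j)"
    have p_ortho: "cinner J p b = 0" if "b \<in> ?N" for b
    proof -
      have "cinner J p b = cinner J (\<lambda>j. e j - n j) b" by (rule cinner_cong) (simp_all add: p_def)
      then show ?thesis using n(2)[OF that] by simp
    qed
    have "p \<in> J \<rightarrow>\<^sub>E F"
      unfolding p_def using e N.coordinate_closed[OF n(1)] diff_closed by auto
    then have pW: "p \<in> W" unfolding W_iff using p_ortho by blast
    have p_proj: "cinner J (\<lambda>j. e j - p j) b = 0" if "b \<in> W" for b
    proof -
      have "cinner J (\<lambda>j. e j - p j) b = cinner J n b" by (rule cinner_cong) (simp_all add: p_def)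
      also have "\<dots> = 0" using that n(1) cinner_commute[of J n b] unfolding W_iff by simp
      finally show ?thesis .
    qed
    \<comment> \<open>For uniqueness, \<open>p - q\<close> is orthogonal to both \<open>p\<close>
      and \<open>q\<close>, hence to itself; outside \<open>J\<close> both are
      \<open>undefined\<close>.\<close>
    have "(THE q. q \<in> W \<and> (\<forall>b\<in>W. cinner J (\<lambda>j. e j - q j) b = 0)) = p"
    proof (rule the_equality)
      show "p \<in> W \<and> (\<forall>b\<in>W. cinner J (\<lambda>j. e j - p j) b = 0)" using pW p_proj by blast
      fix q assume q: "q \<in> W \<and> (\<forall>b\<in>W. cinner J (\<lambda>j. e j - q j) b = 0)"
      have "cinner J (\<lambda>j. p j - q j) b = 0" if "b \<in> W" for b
        using p_proj[OF that] q that by (simp add: cinner_linear)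
      then have "cinner J (\<lambda>j. p j - q j) (\<lambda>j. p j - q j) = 0"
        using pW q by (simp add: cinner_diff_right)
      then have "p j - q j = 0" if "j \<in> J" for j
        using cinner_self_eq_0[OF J _ that, of "\<lambda>j. p j - q j"] by blast
      then show "q = p" using pW q unfolding W_iff by (intro PiE_ext[of q J "\<lambda>_. F" p]) auto
    qed
    then have "dep_projection F J X v e = p"
      unfolding dep_projection_def orth_projection_def W_def[symmetric] using e by simp
    then have P: "dep_matrix F J X v (i, k) = p i" if "i \<in> J" for i
      using that k unfolding dep_matrix_def e_def by simp
    have "cinner J (\<lambda>i. dep_matrix F J X v (i, k)) b = 0" if "b \<in> ?N" for b
    proof -
      have "cinner J (\<lambda>i. dep_matrix F J X v (i, k)) b = cinner J p b"
        by (rule cinner_cong) (simp_all add: P)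
      then show ?thesis using p_ortho[OF that] by simp
    qed
    moreover have "n i = of_bool (i = k) - dep_matrix F J X v (i, k)" if "i \<in> J" for i
      using that P e' by (simp add: p_def)
    ultimately show ?thesis using n(1) by blast
  qed
  show ?thesis
    unfolding complement_projection_matrix_def
  proof (intro ballI conjI)
    fix k assume "k \<in> J"
    then obtain n where n: "n \<in> ?N" "\<forall>b\<in>?N. cinner J (\<lambda>i. dep_matrix F J X v (i, k)) b = 0"
      "\<forall>i\<in>J. n i = of_bool (i = k) - dep_matrix F J X v (i, k)" using column by blast
    show "cinner J (\<lambda>i. dep_matrix F J X v (i, k)) b = 0" if "b \<in> ?N" for b using n(2) that by blast
    show "(\<lambda>i. of_bool (i = k) - dep_matrix F J X v (i, k)) \<in> ?N"
      using n(3) by (intro N.subspace_cong[OF n(1)]) blast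
  qed
qed

lemma dep_matrix_eqI:
  assumes "\<And>i k. \<lbrakk>i \<in> J; k \<in> J\<rbrakk> \<Longrightarrow> dep_matrix F J X v (i, k) = dep_matrix F J Y w (i, k)"
  shows "dep_matrix F J X v = dep_matrix F J Y w"
proof
  fix x show "dep_matrix F J X v x = dep_matrix F J Y w x"
    using assms by (cases x; cases "x \<in> J \<times> J") (auto simp: dep_matrix_def)
qed

section \<open>Similarity\<close>

text \<open>The dependencies are the kernel of the matrix, and the projection onto the complement of
  a given subspace is unique.\<close>

lemma (in conj_subfield) dep_matrix_eq_iff_dependencies_eq:
  assumes "finite J"
    and "vectorspace (scalars F) X" "v \<in> J \<rightarrow> carrier X"
    and "vectorspace (scalars F) Y" "w \<in> J \<rightarrow> carrier Y"
  shows "dep_matrix F J X v = dep_matrix F J Y w \<longleftrightarrow> dependencies F J X v = dependencies F J Y w"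
proof -
  interpret V: coordinate_subspace F J "dependencies F J X v"
    by (rule coordinate_subspace_dependencies) fact+
  interpret W: coordinate_subspace F J "dependencies F J Y w"
    by (rule coordinate_subspace_dependencies) fact+
  note P = complement_projection_matrix_dep_matrix[OF assms(2,1,3)]
  note Q = complement_projection_matrix_dep_matrix[OF assms(4,1,5)]
  show ?thesis
  proof
    assume eq: "dep_matrix F J X v = dep_matrix F J Y w"
    show "dependencies F J X v = dependencies F J Y w"
      by (rule Set.set_eqI)
        (simp only: V.mem_iff_complement_projection_matrix[OF P] W.mem_iff_complement_projection_matrix[OF Q] eq)
  next
    assume "dependencies F J X v = dependencies F J Y w"
    with Q have "complement_projection_matrix J (dependencies F J X v) (\<lambda>i k. dep_matrix F J Y w (i, k))"
      by simp
    from V.complement_projection_matrix_unique[OF P this]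
    show "dep_matrix F J X v = dep_matrix F J Y w" by (rule dep_matrix_eqI)
  qed
qed

text \<open>An injective linear map neither creates nor destroys dependencies. Conversely, equal
  dependencies make sending \<open>v j\<close> to \<open>w j\<close> well defined on linear
  combinations, and these exhaust both spaces.\<close>

lemma similar_seq_iff_dependencies_eq:
  assumes J: "finite J"
    and X: "vectorspace (scalars F) X" and v: "spanning_seq F X J v"
    and Y: "vectorspace (scalars F) Y" and w: "spanning_seq F Y J w"
  shows "similar_seq F J X v Y w \<longleftrightarrow> dependencies F J X v = dependencies F J Y w"
proof
  assume "similar_seq F J X v Y w"
  then obtain Q where lin: "linear_map (scalars F) X Y Q" and bij: "bij_betw Q (carrier X) (carrier Y)"
    and Q: "\<And>j. j \<in> J \<Longrightarrow> w j = Q (v j)"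
    unfolding similar_seq_def invertible_linear_def by blast
  interpret X: vectorspace "scalars F" X by (rule X)
  interpret Y: vectorspace "scalars F" Y by (rule Y)
  interpret Q: linear_map "scalars F" X Y Q by (rule lin)
  have vX: "v j \<in> carrier X" if "j \<in> J" for j using v that unfolding spanning_seq_def by blast
  have "(\<Oplus>\<^bsub>X\<^esub>j\<in>J. a j \<odot>\<^bsub>X\<^esub> v j) = \<zero>\<^bsub>X\<^esub> \<longleftrightarrow> (\<Oplus>\<^bsub>Y\<^esub>j\<in>J. a j \<odot>\<^bsub>Y\<^esub> w j) = \<zero>\<^bsub>Y\<^esub>"
    if a: "\<forall>j\<in>J. a j \<in> F" for a
  proof -
    have closed: "(\<lambda>j. a j \<odot>\<^bsub>X\<^esub> v j) \<in> J \<rightarrow> carrier X"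
      using a vX X.smult_closed by auto
    have "Q (\<Oplus>\<^bsub>X\<^esub>j\<in>J. a j \<odot>\<^bsub>X\<^esub> v j) = (\<Oplus>\<^bsub>Y\<^esub>j\<in>J. Q (a j \<odot>\<^bsub>X\<^esub> v j))"
      by (rule Q.hom_finsum[OF closed])
    also have "\<dots> = (\<Oplus>\<^bsub>Y\<^esub>j\<in>J. a j \<odot>\<^bsub>Y\<^esub> w j)"
      using a vX Q w Y.smult_closed unfolding spanning_seq_def
      by (intro Y.M.finsum_cong') (auto simp: Pi_iff)
    finally have eq: "Q (\<Oplus>\<^bsub>X\<^esub>j\<in>J. a j \<odot>\<^bsub>X\<^esub> v j) = (\<Oplus>\<^bsub>Y\<^esub>j\<in>J. a j \<odot>\<^bsub>Y\<^esub> w j)" .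
    have "(\<Oplus>\<^bsub>X\<^esub>j\<in>J. a j \<odot>\<^bsub>X\<^esub> v j) = \<zero>\<^bsub>X\<^esub>
        \<longleftrightarrow> Q (\<Oplus>\<^bsub>X\<^esub>j\<in>J. a j \<odot>\<^bsub>X\<^esub> v j) = Q \<zero>\<^bsub>X\<^esub>"
      using inj_on_eq_iff[OF bij_betw_imp_inj_on[OF bij] X.M.finsum_closed[OF closed] X.M.zero_closed]
      by simp
    then show ?thesis unfolding eq Q.T0_is_0 .
  qed
  then show "dependencies F J X v = dependencies F J Y w" unfolding dependencies_def by blast
next
  assume eq: "dependencies F J X v = dependencies F J Y w"
  have "(\<Oplus>\<^bsub>X\<^esub>j\<in>J. a j \<odot>\<^bsub>X\<^esub> v j) = \<zero>\<^bsub>X\<^esub> \<longleftrightarrow> (\<Oplus>\<^bsub>Y\<^esub>j\<in>J. a j \<odot>\<^bsub>Y\<^esub> w j) = \<zero>\<^bsub>Y\<^esub>"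
    if "a \<in> J \<rightarrow> carrier (scalars F)" for a
  proof -
    have "\<forall>j\<in>J. a j \<in> F" using that by auto
    moreover have "a \<in> dependencies F J X v \<longleftrightarrow> a \<in> dependencies F J Y w" unfolding eq ..
    ultimately show ?thesis unfolding dependencies_def by blast
  qed
  with v w show "similar_seq F J X v Y w"
    unfolding similar_seq_def invertible_linear_def spanning_seq_def
    using linear_map_from_dependencies[OF X Y J, of v w] by blast
qed

theorem (in conj_subfield) similar_seq_iff_dep_matrix_eq:
  assumes "finite J"
    and "vectorspace (scalars F) X" "spanning_seq F X J v"
    and "vectorspace (scalars F) Y" "spanning_seq F Y J w"
  shows "similar_seq F J X v Y w \<longleftrightarrow> dep_matrix F J X v = dep_matrix F J Y w"
proof -
  have "v \<in> J \<rightarrow> carrier X" "w \<in> J \<rightarrow> carrier Y" using assms(3,5) unfolding spanning_seq_def by blast+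
  then show ?thesis
    using similar_seq_iff_dependencies_eq[OF assms] dep_matrix_eq_iff_dependencies_eq assms(1,2,4) by blast
qed

section \<open>Projective similarity\<close>

text \<open>Dividing coefficients by the \<open>c j\<close> compensates the scaling. This makes the
  similarity criterion applicable to the rescaled sequence.\<close>

lemma (in conj_subfield) spanning_seq_scale:
  assumes J: "finite J" and X: "vectorspace (scalars F) X" and v: "spanning_seq F X J v"
    and c: "\<And>j. j \<in> J \<Longrightarrow> c j \<in> F" "\<And>j. j \<in> J \<Longrightarrow> c j \<noteq> 0"
  shows "spanning_seq F X J (\<lambda>j. c j \<odot>\<^bsub>X\<^esub> v j)"
proof -
  interpret X: vectorspace "scalars F" X by (rule X)
  have vX: "v \<in> J \<rightarrow> carrier X" and span: "X.span (v ` J) = carrier X"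
    using v unfolding spanning_seq_def by blast+
  have cvX: "(\<lambda>j. c j \<odot>\<^bsub>X\<^esub> v j) \<in> J \<rightarrow> carrier X"
    using vX c(1) X.smult_closed by auto
  have "x \<in> X.span ((\<lambda>j. c j \<odot>\<^bsub>X\<^esub> v j) ` J)" if x: "x \<in> carrier X" for x
  proof -
    obtain a where "a \<in> J \<rightarrow> carrier (scalars F)" and xa: "x = (\<Oplus>\<^bsub>X\<^esub>j\<in>J. a j \<odot>\<^bsub>X\<^esub> v j)"
      using x unfolding span[symmetric] X.span_image_eq[OF J vX] by blast
    then have a: "a \<in> J \<rightarrow> F" by simp
    have b: "(\<lambda>j. a j / c j) \<in> J \<rightarrow> F" using a c(1) divide_closed by auto
    have "(a j / c j) \<odot>\<^bsub>X\<^esub> (c j \<odot>\<^bsub>X\<^esub> v j) = a j \<odot>\<^bsub>X\<^esub> v j" if "j \<in> J" for j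
    proof -
      have "a j / c j \<in> F" "c j \<in> F" "v j \<in> carrier X" using b c(1) vX that by auto
      then have "(a j / c j * c j) \<odot>\<^bsub>X\<^esub> v j = (a j / c j) \<odot>\<^bsub>X\<^esub> (c j \<odot>\<^bsub>X\<^esub> v j)"
        using X.smult_assoc1[of "a j / c j" "c j" "v j"] by simp
      then show ?thesis using c(2)[OF that] by simp
    qed
    moreover have "a j \<odot>\<^bsub>X\<^esub> v j \<in> carrier X" if "j \<in> J" for j
    proof -
      have "a j \<in> F" "v j \<in> carrier X" using a vX that by auto
      then show ?thesis using X.smult_closed[of "a j" "v j"] by simp
    qed
    ultimately have "x = (\<Oplus>\<^bsub>X\<^esub>j\<in>J. (a j / c j) \<odot>\<^bsub>X\<^esub> (c j \<odot>\<^bsub>X\<^esub> v j))"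
      unfolding xa by (intro X.M.finsum_cong') auto
    then show ?thesis unfolding X.span_image_eq[OF J cvX] using b
      by (intro CollectI exI[of _ "\<lambda>j. a j / c j"]) simp
  qed
  moreover have "X.span ((\<lambda>j. c j \<odot>\<^bsub>X\<^esub> v j) ` J) \<subseteq> carrier X"
    using cvX by (intro X.span_is_subset2) auto
  ultimately show ?thesis unfolding spanning_seq_def using cvX by blast
qed

text \<open>By linearity the scalars move inside \<open>Q\<close>, which reduces projective
  similarity to similarity.\<close>

lemma (in conj_subfield) projectively_similar_iff_similar_scale:
  assumes v: "v \<in> J \<rightarrow> carrier X"
  shows "projectively_similar F J X v Y w \<longleftrightarrow>
    (\<exists>c. (\<forall>j\<in>J. c j \<in> F \<and> cmod (c j) = 1) \<and> similar_seq F J X (\<lambda>j. c j \<odot>\<^bsub>X\<^esub> v j) Y w)"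
proof -
  have "c j \<odot>\<^bsub>Y\<^esub> Q (v j) = Q (c j \<odot>\<^bsub>X\<^esub> v j)"
    if "invertible_linear F X Y Q" "j \<in> J" "c j \<in> F" for Q c j
  proof -
    interpret Q: linear_map "scalars F" X Y Q using that(1) unfolding invertible_linear_def by blast
    have "v j \<in> carrier X" using v that(2) by blast
    then show ?thesis using Q.T_smult[of "c j" "v j"] that(3) by simp
  qed
  then have "(\<forall>j\<in>J. c j \<in> F \<and> cmod (c j) = 1 \<and> w j = c j \<odot>\<^bsub>Y\<^esub> Q (v j)) \<longleftrightarrow>
      (\<forall>j\<in>J. c j \<in> F \<and> cmod (c j) = 1) \<and> (\<forall>j\<in>J. w j = Q (c j \<odot>\<^bsub>X\<^esub> v j))"
    if "invertible_linear F X Y Q" for Q c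
    using that by auto
  then show ?thesis unfolding projectively_similar_def similar_seq_def by blast
qed

text \<open>\<open>b\<close> is a dependency of the rescaled vectors iff the products
  \<open>b j * c j\<close> form a dependency of the original ones, which is the unitary change of
  subspace treated in \<open>complement_projection_matrix_scale\<close>.\<close>

lemma (in conj_subfield) dep_matrix_scale:
  assumes J: "finite J" and X: "vectorspace (scalars F) X" and v: "v \<in> J \<rightarrow> carrier X"
    and c: "\<And>j. j \<in> J \<Longrightarrow> c j \<in> F" "\<And>j. j \<in> J \<Longrightarrow> cmod (c j) = 1"
    and ik: "i \<in> J" "k \<in> J"
  shows "dep_matrix F J X (\<lambda>j. c j \<odot>\<^bsub>X\<^esub> v j) (i, k) = cnj (c i) * c k * dep_matrix F J X v (i, k)"
proof -
  interpret X: vectorspace "scalars F" X by (rule X)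
  interpret V: coordinate_subspace F J "dependencies F J X v"
    by (rule coordinate_subspace_dependencies[OF X J v])
  let ?u = "\<lambda>j. c j \<odot>\<^bsub>X\<^esub> v j"
  have u: "?u \<in> J \<rightarrow> carrier X" using v c(1) X.smult_closed by auto
  interpret U: coordinate_subspace F J "dependencies F J X ?u"
    by (rule coordinate_subspace_dependencies[OF X J u])
  have "(\<Oplus>\<^bsub>X\<^esub>j\<in>J. b j \<odot>\<^bsub>X\<^esub> ?u j) = (\<Oplus>\<^bsub>X\<^esub>j\<in>J. (b j * c j) \<odot>\<^bsub>X\<^esub> v j)" if b: "\<forall>j\<in>J. b j \<in> F" for b
  proof (rule X.M.finsum_cong'[OF refl])
    show "(\<lambda>j. (b j * c j) \<odot>\<^bsub>X\<^esub> v j) \<in> J \<rightarrow> carrier X"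
      using b v c(1) mult_closed X.smult_closed by auto
    fix j assume "j \<in> J"
    then have "b j \<in> F" "c j \<in> F" "v j \<in> carrier X" using b c(1) v by auto
    then show "b j \<odot>\<^bsub>X\<^esub> ?u j = (b j * c j) \<odot>\<^bsub>X\<^esub> v j"
      using X.smult_assoc1[of "b j" "c j" "v j"] by simp
  qed
  then have "dependencies F J X ?u = {b. (\<forall>j\<in>J. b j \<in> F) \<and> (\<lambda>j. b j * c j) \<in> dependencies F J X v}"
    unfolding dependencies_def using c(1) mult_closed by auto
  with V.complement_projection_matrix_scale[OF complement_projection_matrix_dep_matrix[OF X J v] c]
  have "complement_projection_matrix J (dependencies F J X ?u)
      (\<lambda>i k. cnj (c i) * c k * dep_matrix F J X v (i, k))" by simp
  from U.complement_projection_matrix_unique[OF complement_projection_matrix_dep_matrix[OF X J u] this ik]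
  show ?thesis .
qed

lemma (in conj_subfield) cinner_dep_column:
  assumes J: "finite J" and X: "vectorspace (scalars F) X" and v: "v \<in> J \<rightarrow> carrier X"
    and jk: "j \<in> J" "k \<in> J"
  shows "cinner J (dep_column F J X v j) (dep_column F J X v k) = dep_matrix F J X v (k, j)"
proof -
  interpret V: coordinate_subspace F J "dependencies F J X v"
    by (rule coordinate_subspace_dependencies[OF X J v])
  have "cinner J (dep_column F J X v j) (dep_column F J X v k)
      = cinner J (\<lambda>i. dep_matrix F J X v (i, j)) (\<lambda>i. dep_matrix F J X v (i, k))"
    by (rule cinner_cong) (simp_all add: dep_column_def)
  also have "\<dots> = dep_matrix F J X v (k, j)"
    by (rule V.complement_projection_matrix_gram[OF complement_projection_matrix_dep_matrix[OF X J v] jk])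
  finally show ?thesis .
qed

theorem (in conj_subfield) projectively_similar_iff_canonical_m_products_eq:
  assumes J: "finite J"
    and X: "vectorspace (scalars F) X" and v: "spanning_seq F X J v"
    and Y: "vectorspace (scalars F) Y" and w: "spanning_seq F Y J w"
  shows "projectively_similar F J X v Y w \<longleftrightarrow>
    (\<forall>js\<in>index_tuples J. canonical_m_product F J X v js = canonical_m_product F J Y w js)"
proof -
  have vX: "v \<in> J \<rightarrow> carrier X" and wY: "w \<in> J \<rightarrow> carrier Y"
    using v w unfolding spanning_seq_def by blast+
  define G where "G = (\<lambda>i j. cinner J (dep_column F J X v i) (dep_column F J X v j))"
  define H where "H = (\<lambda>i j. cinner J (dep_column F J Y w i) (dep_column F J Y w j))"
  have G: "G i j = dep_matrix F J X v (j, i)" and H: "H i j = dep_matrix F J Y w (j, i)"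
    if "i \<in> J" "j \<in> J" for i j
    unfolding G_def H_def
    by (rule cinner_dep_column[OF J X vX that]) (rule cinner_dep_column[OF J Y wY that])
  have herm: "G j i = cnj (G i j)" "H j i = cnj (H i j)"
    if "i \<in> J" "j \<in> J" for i j
    unfolding G_def H_def by (rule cinner_commute)+
  have GF: "G i j \<in> F" and HF: "H i j \<in> F" if "i \<in> J" "j \<in> J" for i j
    unfolding G[OF that] H[OF that]
    by (rule coordinate_subspace.complement_projection_matrix_closed[OF
        coordinate_subspace_dependencies[OF X J vX]
        complement_projection_matrix_dep_matrix[OF X J vX] that(2,1)])
      (rule coordinate_subspace.complement_projection_matrix_closed[OF
        coordinate_subspace_dependencies[OF Y J wY]
        complement_projection_matrix_dep_matrix[OF Y J wY] that(2,1)])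
  have prod_G: "canonical_m_product F J X v js = walk_product G (js @ [hd js])"
    and prod_H: "canonical_m_product F J Y w js = walk_product H (js @ [hd js])" if "js \<noteq> []" for js
    unfolding canonical_m_product_def m_product_conv_walk_product[OF that] G_def H_def by (rule refl)+
  have ne: "js \<noteq> []" and sub: "set js \<subseteq> J" if "js \<in> index_tuples J" for js
    using that unfolding index_tuples_def by auto
  \<comment> \<open>For fixed phases, similarity to the rescaled sequence is an entrywise condition
    on the Gram matrices; what remains is whether such phases exist.\<close>
  have similar: "similar_seq F J X (\<lambda>j. c j \<odot>\<^bsub>X\<^esub> v j) Y w
      \<longleftrightarrow> (\<forall>i\<in>J. \<forall>j\<in>J. H i j = c i * cnj (c j) * G i j)"
    if c: "\<And>j. j \<in> J \<Longrightarrow> c j \<in> F" "\<And>j. j \<in> J \<Longrightarrow> cmod (c j) = 1" for c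
  proof -
    let ?u = "\<lambda>j. c j \<odot>\<^bsub>X\<^esub> v j"
    have "c j \<noteq> 0" if "j \<in> J" for j using c(2)[OF that] by auto
    with c(1) have "spanning_seq F X J ?u" by (rule spanning_seq_scale[OF J X v])
    from similar_seq_iff_dep_matrix_eq[OF J X this Y w]
    have "similar_seq F J X ?u Y w \<longleftrightarrow> dep_matrix F J X ?u = dep_matrix F J Y w" .
    also have "\<dots> \<longleftrightarrow> (\<forall>i\<in>J. \<forall>j\<in>J. dep_matrix F J Y w (j, i) = dep_matrix F J X ?u (j, i))"
    proof
      assume "\<forall>i\<in>J. \<forall>j\<in>J. dep_matrix F J Y w (j, i) = dep_matrix F J X ?u (j, i)"
      then show "dep_matrix F J X ?u = dep_matrix F J Y w" by (intro dep_matrix_eqI) simp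
    qed simp
    \<comment> \<open>Entry \<open>(j, i)\<close> of the rescaled matrix carries the factor
      \<open>cnj (c j) * c i\<close>, which matches the transposed indexing of \<open>G\<close> and
      \<open>H\<close>.\<close>
    also have "\<dots> \<longleftrightarrow> (\<forall>i\<in>J. \<forall>j\<in>J. H i j = c i * cnj (c j) * G i j)"
      by (intro ball_cong refl) (simp add: G H dep_matrix_scale[OF J X vX c] mult.commute)
    finally show ?thesis .
  qed
  show ?thesis
  proof
    assume "projectively_similar F J X v Y w"
    then obtain c where cF: "\<And>j. j \<in> J \<Longrightarrow> c j \<in> F" and c1: "\<And>j. j \<in> J \<Longrightarrow> cmod (c j) = 1"
      and "similar_seq F J X (\<lambda>j. c j \<odot>\<^bsub>X\<^esub> v j) Y w"
      unfolding projectively_similar_iff_similar_scale[OF vX] by blast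
    then have HG: "H i j = c i * cnj (c j) * G i j" if "i \<in> J" "j \<in> J" for i j
      using similar[of c] cF c1 that by simp
    have unit: "c j * cnj (c j) = 1" if "j \<in> J" for j
      using c1[OF that] complex_norm_square[of "c j"] by simp
    show "\<forall>js\<in>index_tuples J. canonical_m_product F J X v js = canonical_m_product F J Y w js"
    proof
      fix js assume js: "js \<in> index_tuples J"
      have hd: "hd js \<in> J" using hd_in_set[OF ne[OF js]] sub[OF js] by blast
      then have xs: "set (js @ [hd js]) \<subseteq> J" using sub[OF js] by simp
      have "walk_product H (js @ [hd js]) = walk_product (\<lambda>i j. c i * cnj (c j) * G i j) (js @ [hd js])"
        using HG xs by (rule walk_product_cong)
      also have "\<dots> = c (hd js) * cnj (c (hd js)) * walk_product G (js @ [hd js])"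
        using walk_product_scale[of J c, OF unit _ xs] ne[OF js] by simp
      finally show "canonical_m_product F J X v js = canonical_m_product F J Y w js"
        unfolding prod_G[OF ne[OF js]] prod_H[OF ne[OF js]] using unit[OF hd] by simp
    qed
  next
    assume eq: "\<forall>js\<in>index_tuples J. canonical_m_product F J X v js = canonical_m_product F J Y w js"
    have short: "walk_product G (js @ [hd js]) = walk_product H (js @ [hd js])"
      if "js \<in> index_tuples J" for js
      using eq that prod_G[OF ne[OF that]] prod_H[OF ne[OF that]] by simp
    have closed: "walk_product G (js @ [hd js]) = walk_product H (js @ [hd js])"
      if "js \<noteq> []" "set js \<subseteq> J" for js
      using J short that by (rule closed_walk_products_eq)
    obtain c where cF: "\<And>j. j \<in> J \<Longrightarrow> c j \<in> F" and c1: "\<And>j. j \<in> J \<Longrightarrow> cmod (c j) = 1"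
      and HG: "\<forall>i\<in>J. \<forall>j\<in>J. H i j = c i * cnj (c j) * G i j"
      using phases_from_closed_walks[of J G H] GF HF herm closed by blast
    have "similar_seq F J X (\<lambda>j. c j \<odot>\<^bsub>X\<^esub> v j) Y w"
      using similar[of c] cF c1 HG by simp
    then show "projectively_similar F J X v Y w"
      unfolding projectively_similar_iff_similar_scale[OF vX] using cF c1 by blast
  qed
qed

theorem theorem5p2:
  fixes F :: "complex set" and J :: "'j set"
    and X :: "(complex, 'a) module" and v :: "'j \<Rightarrow> 'a"
    and Y :: "(complex, 'b) module" and w :: "'j \<Rightarrow> 'b"
  assumes "subfield F (class_ring :: complex ring)" and "\<forall>z\<in>F. cnj z \<in> F"
    and "finite J"
    and "vectorspace (scalars F) X" and "spanning_seq F X J v"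
    and "vectorspace (scalars F) Y" and "spanning_seq F Y J w"
  shows "(similar_seq F J X v Y w \<longleftrightarrow> dep_matrix F J X v = dep_matrix F J Y w) \<and>
    (\<forall>D. determining_set J (cinner J) (dep_column F J X v) D \<longrightarrow>
       (projectively_similar F J X v Y w \<longleftrightarrow>
        (\<forall>js\<in>D. canonical_m_product F J X v js = canonical_m_product F J Y w js))) \<and>
    determining_set J (cinner J) (dep_column F J X v) (index_tuples J)"
proof -
  interpret conj_subfield F using assms(1,2) by (intro conj_subfield.intro) auto
  have all: "projectively_similar F J X v Y w \<longleftrightarrow>
      (\<forall>js\<in>index_tuples J. canonical_m_product F J X v js = canonical_m_product F J Y w js)"
    by (rule projectively_similar_iff_canonical_m_products_eq[OF assms(3-7)])
  have "projectively_similar F J X v Y w \<longleftrightarrow>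
      (\<forall>js\<in>D. canonical_m_product F J X v js = canonical_m_product F J Y w js)"
    if D: "determining_set J (cinner J) (dep_column F J X v) D" for D
  proof -
    have sub: "D \<subseteq> index_tuples J" using D unfolding determining_set_def by blast
    \<comment> \<open>The columns of the second projection form a sequence in a complex inner
      product space, so \<open>D\<close> being determining applies to them.\<close>
    have col: "dep_column F J Y w \<in> J \<rightarrow> carrier (LinearCombinations.ring.func_space class_ring J)"
      by (auto simp: dep_column_def class_ring.func_space_def)
    have "\<forall>js\<in>index_tuples J. canonical_m_product F J X v js = canonical_m_product F J Y w js"
      if "\<forall>js\<in>D. canonical_m_product F J X v js = canonical_m_product F J Y w js"
      using determining_set_any_space[OF D assms(3)
          coordinate_space_complex_inner_product_space[OF assms(3)] col] that
      unfolding canonical_m_product_def by simp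
    then show ?thesis unfolding all using sub by blast
  qed
  \<comment> \<open>For the set of all tuples, the assumed agreement of a competing sequence is
    already the conclusion.\<close>
  moreover have "determining_set J (cinner J) (dep_column F J X v) (index_tuples J)"
    unfolding determining_set_def by blast
  ultimately show ?thesis using similar_seq_iff_dep_matrix_eq[OF assms(3-7)] by blast
qed

end
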